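(* Let $\Psi=\{\phi_\tau\}_{\tau\in T\setminus\{\emptyset\}}$ be a conformal TIFS on $X$ and let $J$ be its limit set. Let $t\ge 0$. Then: (i) If $Z_\infty^*(t)=0$, then $\dim_H(J)\le t$. (ii) Suppose in addition that $$\lim_{|\tau|\to\infty}\frac{1}{|\tau|}\log \# I_\tau=0 .$$ Then, if $Z_\infty^*(t)>0$, we have $\dim_H(J)\ge t$. In particular, if the limit condition in (ii) is satisfied, then $\dim_H(J)=\beta^*(\Psi)$. Here $\dim_H$ denotes Hausdorff dimension.
   Context: Trees. A rooted tree is a partially ordered set $(T,\preceq)$ with a minimum element $\emptyset$ (the root) such that for every $\tau\in T$ the set $\{\tau'\in T: \tau'\preceq\tau\}$ is order isomorphic to $(\{0,\dots,n\},\le)$ for some $n\ge 0$; this $n$ is the height $|\tau|$. Write $\tau\prec\omega$ if $\tau\preceq\omega$ and $\tau\neq\omega$. The set of successors of $\tau$ is $I_\tau=\{\omega\in T:\omega\succ\tau,\ |\omega|=|\tau|+1\}$. $T$ is assumed pruned and finitely splitting: $1\le \# I_\tau<\infty$ for every $\tau\in T$. For $n\ge 0$ let $T^{(\le n)}=\{\tau\in T:|\tau|\le n\}$. For $\tau\in T$ and $0\le n\le|\tau|$, $\tau|_n$ is the unique element with $\tau|_n\preceq\tau$ and $|\tau|_n|=n$. $\partial T$ is the set of infinite paths $\omega=(\emptyset=\omega|_0,\omega|_1,\omega|_2,\dots)$ with $\omega|_{n+1}\in I_{\omega|_n}$ for all $n$. TIFS. Let $X$ be a (nonempty) compact connected metric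 space. A Tree Iterated Function System (TIFS) is a family $\{\phi_\tau:X\to X\}_{\tau\in T\setminus\{\emptyset\}}$ for which there is $s\in(0,1)$ such that every $\phi_\tau$ is Lipschitz with constant $s$. Put $\Phi_\tau=\phi_{\tau|_1}\circ\phi_{\tau|_2}\circ\cdots\circ\phi_{\tau|_n}$ for $|\tau|=n\ge1$, and $\Phi_\emptyset=\mathrm{Id}_X$. For $\omega\in\partial T$, the set $\bigcap_{n\ge1}\Phi_{\omega|_n}(X)$ is a single point, denoted $\pi(\omega)$; the limit set is $J=\pi(\partial T)$. Conformal TIFS (CTIFS). A TIFS is conformal if: 1. (Conformality) $X\subset\mathbb R^d$ for some $d\ge1$ (with the Euclidean metric), and there is an open set $V$ with $X\subset V\subset\mathbb R^d$ such that every $\phi_\tau$ extends to a map $V\to V$ (same notation) which is a $C^1$ diffeomorphism onto its image and conformal on $V$ (its derivative at each point is a nonzero scalar multiple of an orthogonal map); $\Phi_\tau$ is extended to $V$ accordingly. 2. (Open set condition) For all $\tau\in T$ and distinct $\omega,\rho\in I_\tau$, $\phi_\omega(\mathrm{Int}(X))\cap\phi_\rho(\mathrm{Int}(X))=\emptyset$, where $\mathrm{Int}$ is the interior in $\mathbb R^d$. 3. (Cone condition) There exist $0<\alpha<\pi$ and $l>0$ such that for every $x\in\partial X$ there is a unit vector $v\in\mathbb R^d$ with $\{y\in\mathbb R^d:0<\|y-x\|<l,\ (y-x,v)>\cos\alpha\}\subset\mathrm{Int}(X)$, where this set is the paper's notation $\mathrm{Con}(x,\alpha,l,v)$ for the open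 cone with vertex $x$, altitude $l$, angle $\alpha$, direction $v$. 4. (Bounded distortion) There is $K\ge1$ such that $|\Phi_\tau'(x)|\le K|\Phi_\tau'(y)|$ for all $\tau\in T$, $x,y\in V$, where $|\Phi_\tau'(x)|$ is the operator norm of the derivative. Put $\|\Phi_\omega'\|=\sup_{x\in X}|\Phi_\omega'(x)|$. An antichain in a poset is a subset whose distinct elements are pairwise incomparable; it is maximal if it is maximal under inclusion among antichains of that poset. For $n\ge1$ and $t\ge0$, $$Z_n^*(t)=\min\Big\{\sum_{\omega\in A}\|\Phi_\omega'\|^t : A \text{ is a maximal antichain in } T^{(\le n)}\setminus\{\emptyset\}\Big\}.$$ $Z_n^*(t)$ is non-increasing in $n$; $Z_\infty^*(t)=\lim_{n\to\infty}Z_n^*(t)$, and $\beta^*(\Psi)=\inf\{t\ge0: Z_\infty^*(t)=0\}$.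
   Formalization: In the cone condition, the printed inequality (y-x,v) > cos(alpha) is read as (y-x,v) > cos(alpha)·‖y-x‖, i.e. a genuine open cone; taken literally the set can be empty, the condition vacuous, and (ii) false. *)

theory Defs
  imports "HOL-Analysis.Analysis"
begin

section \<open>Hausdorff dimension\<close>

text \<open>The contribution of one set to a Hausdorff sum of exponent \<open>s \<ge> 0\<close>. The case \<open>s = 0\<close> is
  separate because \<open>0 powr 0 = 0\<close>, whereas a nonempty set must count \<open>1\<close>.\<close>

definition diam_power :: "real \<Rightarrow> 'a::metric_space set \<Rightarrow> ennreal" where
  "diam_power s U = (if U = {} then 0 else if s = 0 then 1 else ennreal (diameter U powr s))"

text \<open>Boundedness is demanded explicitly: \<^const>\<open>diameter\<close> is meaningless on unbounded sets.\<close>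

definition delta_covers :: "real \<Rightarrow> 'a::metric_space set \<Rightarrow> (nat \<Rightarrow> 'a set) set" where
  "delta_covers \<delta> E = {U. E \<subseteq> (\<Union>i. U i) \<and> (\<forall>i. bounded (U i) \<and> diameter (U i) \<le> \<delta>)}"

definition hausdorff_measure :: "real \<Rightarrow> 'a::metric_space set \<Rightarrow> ennreal" where
  "hausdorff_measure s E = (SUP \<delta>\<in>{0<..}. INF U\<in>delta_covers \<delta> E. \<Sum>i. diam_power s (U i))"

definition hausdorff_dim :: "'a::metric_space set \<Rightarrow> ereal" where
  "hausdorff_dim E = (INF s\<in>{s. 0 \<le> s \<and> hausdorff_measure s E = 0}. ereal s)"

section \<open>Posets and antichains\<close>

definition order_isomorphic ::
  "'a set \<Rightarrow> ('a \<Rightarrow> 'a \<Rightarrow> bool) \<Rightarrow> 'b set \<Rightarrow> ('b \<Rightarrow> 'b \<Rightarrow> bool) \<Rightarrow> bool" where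
  "order_isomorphic A leA B leB \<longleftrightarrow>
     (\<exists>f. bij_betw f A B \<and> (\<forall>x\<in>A. \<forall>y\<in>A. leA x y \<longleftrightarrow> leB (f x) (f y)))"

definition antichain_in :: "'a set \<Rightarrow> ('a \<Rightarrow> 'a \<Rightarrow> bool) \<Rightarrow> 'a set \<Rightarrow> bool" where
  "antichain_in P le A \<longleftrightarrow> A \<subseteq> P \<and> (\<forall>x\<in>A. \<forall>y\<in>A. x \<noteq> y \<longrightarrow> \<not> le x y \<and> \<not> le y x)"

definition maximal_antichain_in :: "'a set \<Rightarrow> ('a \<Rightarrow> 'a \<Rightarrow> bool) \<Rightarrow> 'a set \<Rightarrow> bool" where
  "maximal_antichain_in P le A \<longleftrightarrow>
     antichain_in P le A \<and> (\<forall>B. antichain_in P le B \<longrightarrow> A \<subseteq> B \<longrightarrow> B = A)"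

section \<open>Trees\<close>

locale rooted_tree =
  fixes T :: "'t set" and le :: "'t \<Rightarrow> 't \<Rightarrow> bool" (infix "\<preceq>" 50) and root :: 't
  assumes le_refl: "reflp_on T (\<preceq>)"
    and le_antisym: "antisymp_on T (\<preceq>)"
    and le_trans: "transp_on T (\<preceq>)"
    and root_in: "root \<in> T"
    and root_min: "\<tau> \<in> T \<Longrightarrow> root \<preceq> \<tau>"
    and initial_segments:
      "\<tau> \<in> T \<Longrightarrow> \<exists>n. order_isomorphic {\<sigma>\<in>T. \<sigma> \<preceq> \<tau>} (\<preceq>) {0..n::nat} (\<le>)"
begin

definition height :: "'t \<Rightarrow> nat" where
  "height \<tau> = (THE n. order_isomorphic {\<sigma>\<in>T. \<sigma> \<preceq> \<tau>} (\<preceq>) {0..n::nat} (\<le>))"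

definition successors :: "'t \<Rightarrow> 't set" where
  "successors \<tau> = {\<omega>\<in>T. \<tau> \<preceq> \<omega> \<and> \<tau> \<noteq> \<omega> \<and> height \<omega> = height \<tau> + 1}"

definition truncation :: "nat \<Rightarrow> 't set" where
  "truncation n = {\<tau>\<in>T. height \<tau> \<le> n}"

definition restriction :: "'t \<Rightarrow> nat \<Rightarrow> 't" where
  "restriction \<tau> n = (THE \<sigma>. \<sigma> \<in> T \<and> \<sigma> \<preceq> \<tau> \<and> height \<sigma> = n)"

definition infinite_paths :: "(nat \<Rightarrow> 't) set" where
  "infinite_paths = {\<omega>. \<omega> 0 = root \<and> (\<forall>n. \<omega> (Suc n) \<in> successors (\<omega> n))}"

definition subexponential_splitting :: bool where
  "subexponential_splitting \<longleftrightarrow>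
     ((\<lambda>\<tau>. 1 / real (height \<tau>) * ln (real (card (successors \<tau>)))) \<longlongrightarrow> 0)
       (inf (filtercomap height at_top) (principal T))"

end

locale pruned_finitely_splitting_tree = rooted_tree T le root
  for T :: "'t set" and le :: "'t \<Rightarrow> 't \<Rightarrow> bool" (infix "\<preceq>" 50) and root :: 't +
  assumes pruned: "\<tau> \<in> T \<Longrightarrow> successors \<tau> \<noteq> {}"
    and finitely_splitting: "\<tau> \<in> T \<Longrightarrow> finite (successors \<tau>)"

section \<open>Tree iterated function systems\<close>

text \<open>The space \<open>X\<close> is a subset of an ambient metric space, and each \<open>\<phi> \<tau>\<close> is a total function of
  which only the values on \<open>X\<close> (later: on an open \<open>V \<supseteq> X\<close>) and the indices
  \<open>\<tau> \<in> T - {root}\<close> matter.\<close>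

locale TIFS = pruned_finitely_splitting_tree T le root
  for T :: "'t set" and le :: "'t \<Rightarrow> 't \<Rightarrow> bool" (infix "\<preceq>" 50) and root :: 't +
  fixes X :: "'a::metric_space set" and \<phi> :: "'t \<Rightarrow> 'a \<Rightarrow> 'a"
  assumes X_nonempty: "X \<noteq> {}"
    and X_compact: "compact X"
    and X_connected: "connected X"
    and phi_maps: "\<tau> \<in> T - {root} \<Longrightarrow> \<phi> \<tau> ` X \<subseteq> X"
    and phi_contracts: "\<exists>s. 0 < s \<and> s < 1 \<and> (\<forall>\<tau>\<in>T - {root}. s-lipschitz_on X (\<phi> \<tau>))"
begin

definition \<Phi> :: "'t \<Rightarrow> 'a \<Rightarrow> 'a" where
  "\<Phi> \<tau> = foldr (\<circ>) (map (\<lambda>k. \<phi> (restriction \<tau> k)) [1..<height \<tau> + 1]) id"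

definition coding :: "(nat \<Rightarrow> 't) \<Rightarrow> 'a" where
  "coding \<omega> = the_elem (\<Inter>n\<in>{1..}. \<Phi> (\<omega> n) ` X)"

definition limit_set :: "'a set" where
  "limit_set = coding ` infinite_paths"

end

section \<open>Conformal systems\<close>

definition C1_on :: "'a::real_normed_vector set \<Rightarrow> ('a \<Rightarrow> 'b::real_normed_vector) \<Rightarrow> bool" where
  "C1_on S f \<longleftrightarrow> open S \<and>
     (\<exists>f' :: 'a \<Rightarrow> 'a \<Rightarrow>\<^sub>L 'b. continuous_on S f' \<and>
        (\<forall>x\<in>S. (f has_derivative blinfun_apply (f' x)) (at x)))"

definition C1_diffeo_onto_image ::
  "'a::real_normed_vector set \<Rightarrow> ('a \<Rightarrow> 'b::real_normed_vector) \<Rightarrow> bool" where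
  "C1_diffeo_onto_image V f \<longleftrightarrow>
     C1_on V f \<and> (\<exists>g. C1_on (f ` V) g \<and> (\<forall>x\<in>V. g (f x) = x))"

definition conformal_on :: "'a::euclidean_space set \<Rightarrow> ('a \<Rightarrow> 'a) \<Rightarrow> bool" where
  "conformal_on V f \<longleftrightarrow>
     (\<forall>x\<in>V. \<exists>c Q. c \<noteq> 0 \<and> orthogonal_transformation Q \<and>
        (f has_derivative (\<lambda>h. c *\<^sub>R Q h)) (at x))"

definition deriv_norm :: "('a::real_normed_vector \<Rightarrow> 'b::real_normed_vector) \<Rightarrow> 'a \<Rightarrow> real" where
  "deriv_norm f x = onorm (frechet_derivative f (at x))"

text \<open>The open cone with vertex \<open>x\<close>, opening angle \<open>\<alpha>\<close>, altitude \<open>l\<close> and unit direction \<open>v\<close>: the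
  angle between \<open>y - x\<close> and \<open>v\<close> is less than \<open>\<alpha>\<close>. The factor \<open>norm (y - x)\<close> is essential: without
  it the set is empty as soon as \<open>l \<le> cos \<alpha>\<close>.\<close>

definition open_cone :: "'a::euclidean_space \<Rightarrow> real \<Rightarrow> real \<Rightarrow> 'a \<Rightarrow> 'a set" where
  "open_cone x \<alpha> l v =
     {y. 0 < norm (y - x) \<and> norm (y - x) < l \<and> (y - x) \<bullet> v > cos \<alpha> * norm (y - x)}"

text \<open>The Euclidean space \<open>\<real>\<^sup>d\<close> with \<open>d \<ge> 1\<close> is the type \<open>'a::euclidean_space\<close>.\<close>

locale conformal_TIFS = TIFS T le root X \<phi>
  for T :: "'t set" and le :: "'t \<Rightarrow> 't \<Rightarrow> bool" (infix "\<preceq>" 50) and root :: 't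
    and X :: "'a::euclidean_space set" and \<phi> :: "'t \<Rightarrow> 'a \<Rightarrow> 'a" +
  fixes V :: "'a set"
  assumes V_open: "open V"
    and X_subset_V: "X \<subseteq> V"
    and phi_maps_V: "\<tau> \<in> T - {root} \<Longrightarrow> \<phi> \<tau> ` V \<subseteq> V"
    and phi_diffeo: "\<tau> \<in> T - {root} \<Longrightarrow> C1_diffeo_onto_image V (\<phi> \<tau>)"
    and phi_conformal: "\<tau> \<in> T - {root} \<Longrightarrow> conformal_on V (\<phi> \<tau>)"
    and open_set_condition:
      "\<lbrakk>\<tau> \<in> T; \<omega> \<in> successors \<tau>; \<rho> \<in> successors \<tau>; \<omega> \<noteq> \<rho>\<rbrakk>
        \<Longrightarrow> \<phi> \<omega> ` interior X \<inter> \<phi> \<rho> ` interior X = {}"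
    and cone_condition:
      "\<exists>\<alpha> l. 0 < \<alpha> \<and> \<alpha> < pi \<and> 0 < l \<and>
         (\<forall>x\<in>frontier X. \<exists>v. norm v = 1 \<and> open_cone x \<alpha> l v \<subseteq> interior X)"
    and bounded_distortion:
      "\<exists>K\<ge>1. \<forall>\<tau>\<in>T. \<forall>x\<in>V. \<forall>y\<in>V. deriv_norm (\<Phi> \<tau>) x \<le> K * deriv_norm (\<Phi> \<tau>) y"

context conformal_TIFS
begin

definition sup_deriv_norm :: "'t \<Rightarrow> real" where
  "sup_deriv_norm \<omega> = (SUP x\<in>X. deriv_norm (\<Phi> \<omega>) x)"

definition Z_star :: "nat \<Rightarrow> real \<Rightarrow> real" where
  "Z_star n t = Min ((\<lambda>A. \<Sum>\<omega>\<in>A. sup_deriv_norm \<omega> powr t) `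
     {A. maximal_antichain_in (truncation n - {root}) (\<preceq>) A})"

definition Z_star_inf :: "real \<Rightarrow> real" where
  "Z_star_inf t = lim (\<lambda>n. Z_star n t)"

definition beta_star :: ereal where
  "beta_star = (INF t\<in>{t. 0 \<le> t \<and> Z_star_inf t = 0}. ereal t)"

end

end

theory Submission
  imports Defs
begin

text \<open>
  Write \<open>|\<omega>|\<close> for \<open>sup_deriv_norm \<omega>\<close>. By bounded distortion, the derivative of \<open>\<Phi> \<omega>\<close> is comparable
  to \<open>|\<omega>|\<close> everywhere: the image of \<open>X\<close> has diameter at most a constant times \<open>|\<omega>|\<close>
  (\<open>\<Phi>_diameter_le\<close>), and, by the cone condition, for each \<open>r < |\<omega>|\<close> it contains balls of
  radius comparable to \<open>r\<close> within distance comparable to \<open>r\<close> of each of its points.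

  Upper bound: the images of \<open>X\<close> under the maps of a maximal antichain cover the limit set, so a small
  antichain sum gives a cover with a small Hausdorff sum (\<open>hausdorff_dim_limit_set_le\<close>).

  Lower bound: one usually builds a measure on the tree by the max-flow min-cut theorem and applies
  the mass distribution principle. Here the argument is run in the opposite, more elementary
  direction: a cover of the limit set with small Hausdorff sum is converted into a maximal antichain
  with small sum. Replace each member \<open>U\<close> of the cover, of diameter at most \<open>r\<close>, by the nodes whose
  images meet \<open>U\<close> and at which the derivative norm drops from above \<open>r\<close> to at most \<open>r\<close>. Every
  infinite path contains such a node for some \<open>U\<close>, and Koenig's lemma then yields a maximal antichain
  of such nodes in a finite truncation (\<open>cut_contains_maximal_antichain\<close>). For one \<open>U\<close>, the parents
  of these nodes on each level are boundedly many, by comparing the volumes of disjoint balls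
  of radius comparable to \<open>r\<close> near \<open>U\<close> (\<open>large_images_card_bound\<close>); since norms decrease geometrically and
  the splitting is subexponential, the total number of nodes is at most a small negative power of
  \<open>r\<close>, which a slight loss in the exponent absorbs (\<open>crossing_sum_bound\<close>).

  The equality of the dimension and the critical exponent follows from both bounds.
\<close>

section \<open>Trees as posets\<close>

context rooted_tree
begin

lemma tree_trans: "\<lbrakk>x \<preceq> y; y \<preceq> z; x \<in> T; y \<in> T; z \<in> T\<rbrakk> \<Longrightarrow> x \<preceq> z"
  using transp_onD[OF le_trans] by blast

lemma tree_refl: "x \<in> T \<Longrightarrow> x \<preceq> x"
  using reflp_onD[OF le_refl] by blast

lemma tree_antisym: "\<lbrakk>x \<preceq> y; y \<preceq> x; x \<in> T; y \<in> T\<rbrakk> \<Longrightarrow> x = y"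
  using antisymp_onD[OF le_antisym] by blast

lemma height_eqI:
  assumes "order_isomorphic {\<sigma>\<in>T. \<sigma> \<preceq> \<tau>} (\<preceq>) {0..n::nat} (\<le>)"
  shows "height \<tau> = n"
proof -
  have card: "card {\<sigma>\<in>T. \<sigma> \<preceq> \<tau>} = m + 1"
    if m: "order_isomorphic {\<sigma>\<in>T. \<sigma> \<preceq> \<tau>} (\<preceq>) {0..m::nat} (\<le>)" for m
  proof -
    obtain f where "bij_betw f {\<sigma>\<in>T. \<sigma> \<preceq> \<tau>} {0..m}"
      using m unfolding order_isomorphic_def by blast
    from bij_betw_same_card[OF this] show ?thesis by simp
  qed
  show ?thesis
    unfolding height_def
  proof (rule the_equality)
    show "m = n" if "order_isomorphic {\<sigma>\<in>T. \<sigma> \<preceq> \<tau>} (\<preceq>) {0..m::nat} (\<le>)" for m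
      using card[OF that] card[OF assms] by simp
  qed (rule assms)
qed

text \<open>The order isomorphism that the axioms provide for \<open>\<tau>\<close> restricts to one for each element
  below \<open>\<tau>\<close>, so it can only be the height function itself.\<close>

lemma height_isomorphism:
  assumes "\<tau> \<in> T"
  shows "bij_betw height {\<sigma>\<in>T. \<sigma> \<preceq> \<tau>} {0..height \<tau>}"
    and "\<lbrakk>\<sigma> \<in> T; \<rho> \<in> T; \<sigma> \<preceq> \<tau>; \<rho> \<preceq> \<tau>\<rbrakk> \<Longrightarrow> \<sigma> \<preceq> \<rho> \<longleftrightarrow> height \<sigma> \<le> height \<rho>"
proof -
  obtain n where n: "order_isomorphic {\<sigma>\<in>T. \<sigma> \<preceq> \<tau>} (\<preceq>) {0..n::nat} (\<le>)"
    using initial_segments[OF assms] by blast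
  then obtain f where bij: "bij_betw f {\<sigma>\<in>T. \<sigma> \<preceq> \<tau>} {0..n}"
    and mono: "\<And>x y. \<lbrakk>x \<in> T; y \<in> T; x \<preceq> \<tau>; y \<preceq> \<tau>\<rbrakk> \<Longrightarrow> x \<preceq> y \<longleftrightarrow> f x \<le> f y"
    unfolding order_isomorphic_def by blast
  have f_height: "height \<sigma> = f \<sigma>" if \<sigma>: "\<sigma> \<in> T" "\<sigma> \<preceq> \<tau>" for \<sigma>
  proof -
    have down: "{\<rho>\<in>T. \<rho> \<preceq> \<sigma>} = {\<rho>\<in>{\<rho>\<in>T. \<rho> \<preceq> \<tau>}. f \<rho> \<le> f \<sigma>}"
      using \<sigma> assms mono tree_trans by blast
    have "f \<sigma> \<le> n"
      using bij \<sigma> by (auto simp: bij_betw_def)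
    then have "f ` {\<rho>\<in>T. \<rho> \<preceq> \<sigma>} = {0..f \<sigma>}"
      using bij unfolding down bij_betw_def
      by (auto simp: image_iff set_eq_iff) (metis order.trans)
    moreover have "inj_on f {\<rho>\<in>T. \<rho> \<preceq> \<sigma>}"
      using bij unfolding down by (auto simp: bij_betw_def inj_on_def)
    ultimately have "bij_betw f {\<rho>\<in>T. \<rho> \<preceq> \<sigma>} {0..f \<sigma>}"
      by (simp add: bij_betw_def)
    moreover have "x \<preceq> y \<longleftrightarrow> f x \<le> f y" if "x \<in> T" "y \<in> T" "x \<preceq> \<sigma>" "y \<preceq> \<sigma>" for x y
      using that \<sigma> assms mono tree_trans by blast
    ultimately show ?thesis
      by (intro height_eqI) (auto simp: order_isomorphic_def)
  qed
  show "bij_betw height {\<sigma>\<in>T. \<sigma> \<preceq> \<tau>} {0..height \<tau>}"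
    using bij bij_betw_cong[of "{\<sigma>\<in>T. \<sigma> \<preceq> \<tau>}" height f] f_height height_eqI[OF n] by simp
  show "\<sigma> \<preceq> \<rho> \<longleftrightarrow> height \<sigma> \<le> height \<rho>"
    if "\<sigma> \<in> T" "\<rho> \<in> T" "\<sigma> \<preceq> \<tau>" "\<rho> \<preceq> \<tau>"
    using that mono f_height by simp
qed

lemma height_mono:
  assumes "\<sigma> \<in> T" "\<tau> \<in> T" "\<sigma> \<preceq> \<tau>"
  shows "height \<sigma> \<le> height \<tau>"
  using height_isomorphism(2)[OF assms(2,1,2,3) tree_refl] assms by simp

lemma below_unique:
  assumes "\<tau> \<in> T" "\<sigma> \<in> T" "\<rho> \<in> T" "\<sigma> \<preceq> \<tau>" "\<rho> \<preceq> \<tau>" "height \<sigma> = height \<rho>"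
  shows "\<sigma> = \<rho>"
  using height_isomorphism(2)[OF assms(1)] assms tree_antisym by simp

lemma below_comparable:
  assumes "\<tau> \<in> T" "\<sigma> \<in> T" "\<rho> \<in> T" "\<sigma> \<preceq> \<tau>" "\<rho> \<preceq> \<tau>"
  shows "\<sigma> \<preceq> \<rho> \<or> \<rho> \<preceq> \<sigma>"
  using height_isomorphism(2)[OF assms(1)] assms nat_le_linear by blast

lemma height_root [simp]: "height root = 0"
proof -
  have "{\<sigma>\<in>T. \<sigma> \<preceq> root} = {root}"
    using root_in root_min tree_antisym tree_refl by blast
  then show ?thesis
    using bij_betw_same_card[OF height_isomorphism(1)[OF root_in]] by simp
qed

lemma height_eq_0_iff: "\<tau> \<in> T \<Longrightarrow> height \<tau> = 0 \<longleftrightarrow> \<tau> = root"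
  using below_unique[of \<tau> \<tau> root] tree_refl root_in root_min by auto

lemma
  assumes "\<tau> \<in> T" "k \<le> height \<tau>"
  shows restriction_in: "restriction \<tau> k \<in> T"
    and restriction_le: "restriction \<tau> k \<preceq> \<tau>"
    and height_restriction: "height (restriction \<tau> k) = k"
proof -
  have "k \<in> height ` {\<sigma>\<in>T. \<sigma> \<preceq> \<tau>}"
    using height_isomorphism(1)[OF assms(1)] assms(2) by (simp add: bij_betw_def)
  then have "\<exists>!\<sigma>. \<sigma> \<in> T \<and> \<sigma> \<preceq> \<tau> \<and> height \<sigma> = k"
    using below_unique[OF assms(1)] by blast
  from theI'[OF this] show "restriction \<tau> k \<in> T" "restriction \<tau> k \<preceq> \<tau>"
    "height (restriction \<tau> k) = k"
    unfolding restriction_def by blast+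
qed

lemma restriction_eqI:
  assumes "\<tau> \<in> T" "\<sigma> \<in> T" "\<sigma> \<preceq> \<tau>" "height \<sigma> = k"
  shows "restriction \<tau> k = \<sigma>"
  unfolding restriction_def using assms below_unique by (intro the_equality) auto

lemma restriction_of_below:
  assumes "\<tau> \<in> T" "\<sigma> \<in> T" "\<sigma> \<preceq> \<tau>" "k \<le> height \<sigma>"
  shows "restriction \<tau> k = restriction \<sigma> k"
  using assms restriction_in restriction_le height_restriction tree_trans
  by (intro restriction_eqI) blast+

lemma successorsD:
  assumes "\<omega> \<in> successors \<tau>"
  shows "\<omega> \<in> T" "\<tau> \<preceq> \<omega>" "height \<omega> = Suc (height \<tau>)" "\<omega> \<noteq> root"
  using assms by (auto simp: successors_def)

definition parent :: "'t \<Rightarrow> 't" where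
  "parent \<tau> = restriction \<tau> (height \<tau> - 1)"

lemma
  assumes "\<tau> \<in> T" "\<tau> \<noteq> root"
  shows parent_in: "parent \<tau> \<in> T"
    and parent_le: "parent \<tau> \<preceq> \<tau>"
    and height_parent: "Suc (height (parent \<tau>)) = height \<tau>"
    and in_successors_parent: "\<tau> \<in> successors (parent \<tau>)"
  using assms restriction_in[of \<tau> "height \<tau> - 1"] restriction_le[of \<tau> "height \<tau> - 1"]
    height_restriction[of \<tau> "height \<tau> - 1"] height_eq_0_iff[of \<tau>]
  by (auto simp: parent_def successors_def)

lemma parent_eqI: "\<lbrakk>\<tau> \<in> T; \<omega> \<in> successors \<tau>\<rbrakk> \<Longrightarrow> parent \<omega> = \<tau>"
  unfolding parent_def using successorsD[of \<omega> \<tau>] by (intro restriction_eqI) auto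

lemma infinite_pathD:
  assumes "\<omega> \<in> infinite_paths"
  shows "\<omega> n \<in> T" "height (\<omega> n) = n"
    and "m \<le> n \<Longrightarrow> \<omega> m \<preceq> \<omega> n"
    and "\<omega> (Suc n) \<noteq> root" "parent (\<omega> (Suc n)) = \<omega> n"
proof -
  have step: "\<omega> (Suc n) \<in> successors (\<omega> n)" for n
    using assms by (simp add: infinite_paths_def)
  have in_T: "\<omega> n \<in> T" for n
    using assms step successorsD(1) root_in by (cases n) (auto simp: infinite_paths_def)
  show "\<omega> n \<in> T" by (rule in_T)
  show "height (\<omega> n) = n"
  proof (induction n)
    case 0
    then show ?case using assms by (simp add: infinite_paths_def)
  next
    case (Suc n)
    then show ?case using successorsD(3)[OF step] by simp
  qed
  show "\<omega> m \<preceq> \<omega> n" if "m \<le> n"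
    using that
  proof (induction rule: dec_induct)
    case base
    then show ?case using in_T tree_refl by blast
  next
    case (step k)
    then show ?case using \<open>\<And>n. \<omega> (Suc n) \<in> successors (\<omega> n)\<close> successorsD(2) tree_trans in_T by blast
  qed
  show "\<omega> (Suc n) \<noteq> root" "parent (\<omega> (Suc n)) = \<omega> n"
    using step successorsD(4) parent_eqI[OF in_T] by blast+
qed

end

section \<open>Maximal antichains and cuts\<close>

lemma maximal_antichainD: "maximal_antichain_in P le A \<Longrightarrow> antichain_in P le A"
  by (simp add: maximal_antichain_in_def)

lemma maximal_antichain_comparable:
  assumes "maximal_antichain_in P le A" "x \<in> P"
  shows "\<exists>a\<in>A. x = a \<or> le x a \<or> le a x"
proof (rule ccontr)
  assume *: "\<not> ?thesis"
  then have "antichain_in P le (insert x A)"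
    using assms by (auto simp: maximal_antichain_in_def antichain_in_def)
  then have "insert x A = A"
    using assms(1) unfolding maximal_antichain_in_def by blast
  then show False
    using * by blast
qed

lemma maximal_antichainI:
  assumes "antichain_in P le A" "\<And>x. x \<in> P \<Longrightarrow> \<exists>a\<in>A. x = a \<or> le x a \<or> le a x"
  shows "maximal_antichain_in P le A"
proof -
  have "B = A" if B: "antichain_in P le B" "A \<subseteq> B" for B
  proof -
    have "x \<in> A" if x: "x \<in> B" for x
    proof -
      have "x \<in> P"
        using B x by (auto simp: antichain_in_def)
      then obtain a where "a \<in> A" "x = a \<or> le x a \<or> le a x"
        using assms(2) by blast
      moreover have "x = a"
        using B calculation x unfolding antichain_in_def by (meson subsetD)
      ultimately show ?thesis
        by simp
    qed
    then show ?thesis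
      using B by blast
  qed
  then show ?thesis
    using assms(1) by (auto simp: maximal_antichain_in_def)
qed

context pruned_finitely_splitting_tree
begin

lemma finite_level: "finite {\<tau>\<in>T. height \<tau> = n}"
proof (induction n)
  case 0
  have "{\<tau>\<in>T. height \<tau> = 0} \<subseteq> {root}"
    using height_eq_0_iff by blast
  then show ?case
    using finite_subset by blast
next
  case (Suc n)
  have "{\<tau>\<in>T. height \<tau> = Suc n} \<subseteq> (\<Union>\<sigma>\<in>{\<tau>\<in>T. height \<tau> = n}. successors \<sigma>)"
  proof
    fix \<tau> assume \<tau>: "\<tau> \<in> {\<tau>\<in>T. height \<tau> = Suc n}"
    then have "\<tau> \<noteq> root" by auto
    then have "parent \<tau> \<in> {\<tau>\<in>T. height \<tau> = n}" "\<tau> \<in> successors (parent \<tau>)"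
      using \<tau> parent_in[of \<tau>] height_parent[of \<tau>] in_successors_parent[of \<tau>] by auto
    then show "\<tau> \<in> (\<Union>\<sigma>\<in>{\<tau>\<in>T. height \<tau> = n}. successors \<sigma>)"
      by blast
  qed
  moreover have "finite (\<Union>\<sigma>\<in>{\<tau>\<in>T. height \<tau> = n}. successors \<sigma>)"
    using Suc finitely_splitting by blast
  ultimately show ?case
    by (rule finite_subset)
qed

lemma finite_truncation: "finite (truncation n)"
proof -
  have "truncation n = (\<Union>k\<le>n. {\<tau>\<in>T. height \<tau> = k})"
    by (auto simp: truncation_def)
  then show ?thesis
    using finite_level by simp
qed

lemma extends_to_height:
  assumes "\<tau> \<in> T" "height \<tau> \<le> n"
  shows "\<exists>\<sigma>\<in>T. \<tau> \<preceq> \<sigma> \<and> height \<sigma> = n"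
  using assms(2)
proof (induction rule: dec_induct)
  case base
  then show ?case using assms tree_refl by blast
next
  case (step n)
  then obtain \<sigma> where \<sigma>: "\<sigma> \<in> T" "\<tau> \<preceq> \<sigma>" "height \<sigma> = n" by blast
  then obtain \<rho> where "\<rho> \<in> successors \<sigma>"
    using pruned by blast
  then show ?case
    using \<sigma> successorsD[of \<rho> \<sigma>] tree_trans[of \<tau> \<sigma> \<rho>] assms by blast
qed

text \<open>Koenig's lemma. A node is called secured if all high enough nodes above it have a predecessor
  in \<open>B\<close>; a node all of whose (finitely many) successors are secured is secured, so if the root
  were not, unsecured nodes would form an infinite path, and this path would avoid \<open>B\<close>.\<close>

lemma cut_below_some_level:
  assumes "\<And>\<omega>. \<omega> \<in> infinite_paths \<Longrightarrow> \<exists>n. \<omega> n \<in> B"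
  shows "\<exists>n. \<forall>\<tau>\<in>T. height \<tau> = n \<longrightarrow> (\<exists>b\<in>B \<inter> T. b \<preceq> \<tau>)"
proof -
  define secured where "secured \<tau> \<longleftrightarrow>
    (\<exists>n. \<forall>\<sigma>\<in>T. \<tau> \<preceq> \<sigma> \<and> n \<le> height \<sigma> \<longrightarrow> (\<exists>b\<in>B \<inter> T. b \<preceq> \<sigma>))" for \<tau>
  have secured_if_successors: "secured \<tau>"
    if \<tau>: "\<tau> \<in> T" and succ: "\<forall>\<rho>\<in>successors \<tau>. secured \<rho>" for \<tau>
  proof -
    obtain N where N: "\<And>\<rho> \<sigma>. \<lbrakk>\<rho> \<in> successors \<tau>; \<sigma> \<in> T; \<rho> \<preceq> \<sigma>; N \<rho> \<le> height \<sigma>\<rbrakk>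
        \<Longrightarrow> \<exists>b\<in>B \<inter> T. b \<preceq> \<sigma>"
      using succ unfolding secured_def by metis
    define n where "n = Max (insert (Suc (height \<tau>)) (N ` successors \<tau>))"
    have fin: "finite (insert (Suc (height \<tau>)) (N ` successors \<tau>))"
      using finitely_splitting[OF \<tau>] by blast
    have "\<exists>b\<in>B \<inter> T. b \<preceq> \<sigma>" if \<sigma>: "\<sigma> \<in> T" "\<tau> \<preceq> \<sigma>" "n \<le> height \<sigma>" for \<sigma>
    proof -
      have h: "Suc (height \<tau>) \<le> height \<sigma>"
        using fin \<sigma>(3) unfolding n_def by (simp add: Max_le_iff)
      define \<rho> where "\<rho> = restriction \<sigma> (Suc (height \<tau>))"
      have \<rho>: "\<rho> \<in> T" "\<rho> \<preceq> \<sigma>" "height \<rho> = Suc (height \<tau>)"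
        unfolding \<rho>_def using restriction_in restriction_le height_restriction \<sigma> h by auto
      have "\<tau> \<preceq> \<rho>"
        using height_isomorphism(2)[OF \<sigma>(1) \<tau> \<rho>(1) \<sigma>(2) \<rho>(2)] \<rho>(3) by simp
      then have "\<rho> \<in> successors \<tau>"
        using \<rho> by (auto simp: successors_def)
      moreover then have "N \<rho> \<le> height \<sigma>"
        using fin \<sigma>(3) unfolding n_def by (simp add: Max_le_iff)
      ultimately show ?thesis
        using N \<sigma>(1) \<rho>(2) by blast
    qed
    then show ?thesis
      unfolding secured_def by blast
  qed
  have "secured root"
  proof (rule ccontr)
    assume "\<not> secured root"
    have "\<exists>\<omega>. \<forall>n. (\<omega> n \<in> T \<and> \<not> secured (\<omega> n) \<and> (n = 0 \<longrightarrow> \<omega> n = root))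
        \<and> \<omega> (Suc n) \<in> successors (\<omega> n)"
    proof (rule dependent_nat_choice)
      show "\<exists>x. x \<in> T \<and> \<not> secured x \<and> ((0::nat) = 0 \<longrightarrow> x = root)"
        using \<open>\<not> secured root\<close> root_in by blast
      show "\<exists>y. (y \<in> T \<and> \<not> secured y \<and> (Suc n = 0 \<longrightarrow> y = root)) \<and> y \<in> successors x"
        if "x \<in> T \<and> \<not> secured x \<and> (n = 0 \<longrightarrow> x = root)" for x n
        using that secured_if_successors successorsD(1) by blast
    qed
    then obtain \<omega> where \<omega>: "\<And>n. \<not> secured (\<omega> n)" "\<omega> 0 = root"
      "\<And>n. \<omega> (Suc n) \<in> successors (\<omega> n)"
      by blast
    then have path: "\<omega> \<in> infinite_paths"
      by (simp add: infinite_paths_def)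
    then obtain n where "\<omega> n \<in> B"
      using assms by blast
    then have "secured (\<omega> n)"
      using infinite_pathD(1)[OF path] unfolding secured_def by blast
    then show False
      using \<omega>(1) by blast
  qed
  then obtain n where "\<And>\<sigma>. \<lbrakk>\<sigma> \<in> T; root \<preceq> \<sigma>; n \<le> height \<sigma>\<rbrakk> \<Longrightarrow> \<exists>b\<in>B \<inter> T. b \<preceq> \<sigma>"
    unfolding secured_def by blast
  then show ?thesis
    using root_min by (intro exI[of _ n]) simp
qed

text \<open>The elements of \<open>B\<close> without a predecessor in \<open>B\<close> form an antichain; every node extends to the
  level of the preceding lemma and is thus comparable with one of them.\<close>

lemma cut_contains_maximal_antichain:
  assumes "\<And>\<omega>. \<omega> \<in> infinite_paths \<Longrightarrow> \<exists>n. \<omega> n \<in> B" "root \<notin> B"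
  obtains n A where "n \<ge> 1" "A \<subseteq> B" "maximal_antichain_in (truncation n - {root}) (\<preceq>) A"
proof -
  obtain n where n: "\<And>\<tau>. \<lbrakk>\<tau> \<in> T; height \<tau> = n\<rbrakk> \<Longrightarrow> \<exists>b\<in>B \<inter> T. b \<preceq> \<tau>"
    using cut_below_some_level[OF assms(1)] by blast
  have "n \<ge> 1"
  proof (rule ccontr)
    assume "\<not> n \<ge> 1"
    then have "\<exists>b\<in>B \<inter> T. b \<preceq> root"
      using n[OF root_in] by simp
    then show False
      using assms(2) root_min root_in tree_antisym by blast
  qed
  define A where "A = {a \<in> B \<inter> truncation n. \<forall>b\<in>B \<inter> T. b \<preceq> a \<longrightarrow> b = a}"
  have anti: "antichain_in (truncation n - {root}) (\<preceq>) A"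
    using assms(2) by (auto simp: A_def antichain_in_def truncation_def)
  moreover have "\<exists>a\<in>A. x = a \<or> x \<preceq> a \<or> a \<preceq> x" if x: "x \<in> truncation n - {root}" for x
  proof -
    obtain \<sigma> where \<sigma>: "\<sigma> \<in> T" "x \<preceq> \<sigma>" "height \<sigma> = n"
      using x extends_to_height[of x n] by (auto simp: truncation_def)
    obtain b0 where "b0 \<in> B \<inter> T \<and> b0 \<preceq> \<sigma>"
      using n[OF \<sigma>(1,3)] by blast
    then obtain b where b: "b \<in> B \<inter> T" "b \<preceq> \<sigma>"
      and least: "\<And>c. c \<in> B \<inter> T \<and> c \<preceq> \<sigma> \<Longrightarrow> height b \<le> height c"
      using arg_min_nat_lemma[of "\<lambda>b. b \<in> B \<inter> T \<and> b \<preceq> \<sigma>" b0 height] by blast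
    have "b \<in> A"
    proof -
      have "c = b" if c: "c \<in> B \<inter> T" "c \<preceq> b" for c
      proof -
        have "c \<preceq> \<sigma>" using tree_trans[of c b \<sigma>] c b \<sigma> by blast
        then have "height c = height b"
          using least c height_mono[of c b] b by force
        then show ?thesis
          using below_unique[of \<sigma> c b] \<sigma> \<open>c \<preceq> \<sigma>\<close> b c by blast
      qed
      moreover have "height b \<le> n"
        using height_mono[of b \<sigma>] b \<sigma> by auto
      ultimately show ?thesis
        using b by (auto simp: A_def truncation_def)
    qed
    then show ?thesis
      using below_comparable[of \<sigma> x b] \<sigma> b x by (auto simp: truncation_def)
  qed
  ultimately have "maximal_antichain_in (truncation n - {root}) (\<preceq>) A"
    by (intro maximal_antichainI) auto
  then show ?thesis
    using that[of n A] \<open>n \<ge> 1\<close> by (auto simp: A_def)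
qed

lemma maximal_antichain_meets_path:
  assumes "maximal_antichain_in (truncation n - {root}) (\<preceq>) A" "n \<ge> 1" "\<omega> \<in> infinite_paths"
  shows "\<exists>k. \<omega> k \<in> A"
proof -
  have "\<omega> n \<in> truncation n - {root}"
    using assms(2) infinite_pathD(1,2)[OF assms(3), of n] height_root
    by (auto simp: truncation_def simp del: height_root)
  then obtain a where a: "a \<in> A" "\<omega> n = a \<or> \<omega> n \<preceq> a \<or> a \<preceq> \<omega> n"
    using maximal_antichain_comparable[OF assms(1)] by blast
  moreover have aT: "a \<in> T" "height a \<le> n"
    using maximal_antichainD[OF assms(1)] a by (auto simp: antichain_in_def truncation_def)
  ultimately have "a \<preceq> \<omega> n"
    using height_isomorphism(2)[of a a "\<omega> n"] infinite_pathD(1,2)[OF assms(3), of n] tree_refl by auto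
  then have "a = \<omega> (height a)"
    using below_unique[of "\<omega> n" a "\<omega> (height a)"] infinite_pathD[OF assms(3)] aT by simp
  then show ?thesis
    using a by metis
qed

lemma maximal_antichain_truncation_Suc:
  assumes "maximal_antichain_in (truncation n - {root}) (\<preceq>) A" "n \<ge> 1"
  shows "maximal_antichain_in (truncation (Suc n) - {root}) (\<preceq>) A"
proof (rule maximal_antichainI)
  show "antichain_in (truncation (Suc n) - {root}) (\<preceq>) A"
    using maximal_antichainD[OF assms(1)] by (auto simp: antichain_in_def truncation_def)
  fix x assume x: "x \<in> truncation (Suc n) - {root}"
  show "\<exists>a\<in>A. x = a \<or> x \<preceq> a \<or> a \<preceq> x"
  proof (cases "height x \<le> n")
    case True
    then show ?thesis
      using x maximal_antichain_comparable[OF assms(1), of x] by (auto simp: truncation_def)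
  next
    case False
    then have p: "x \<in> T" "height (parent x) = n" "parent x \<in> T" "parent x \<preceq> x"
      using x height_parent[of x] parent_in[of x] parent_le[of x] by (auto simp: truncation_def)
    then have "parent x \<in> truncation n - {root}"
      using assms(2) height_root by (auto simp: truncation_def simp del: height_root)
    then obtain a where a: "a \<in> A" "parent x = a \<or> parent x \<preceq> a \<or> a \<preceq> parent x"
      using maximal_antichain_comparable[OF assms(1)] by blast
    moreover have aT: "a \<in> T" "height a \<le> n"
      using maximal_antichainD[OF assms(1)] a by (auto simp: antichain_in_def truncation_def)
    ultimately have "a \<preceq> parent x"
      using height_isomorphism(2)[of a a "parent x"] p tree_refl by auto
    then show ?thesis
      using a tree_trans[of a "parent x" x] aT p by blast
  qed
qed

lemma level_maximal_antichain:
  assumes "n \<ge> 1"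
  shows "maximal_antichain_in (truncation n - {root}) (\<preceq>) {\<tau>\<in>T. height \<tau> = n}"
proof (rule maximal_antichainI)
  show "antichain_in (truncation n - {root}) (\<preceq>) {\<tau> \<in> T. height \<tau> = n}"
    using assms tree_refl below_unique by (auto simp: antichain_in_def truncation_def)
  show "\<exists>a\<in>{\<tau> \<in> T. height \<tau> = n}. x = a \<or> x \<preceq> a \<or> a \<preceq> x"
    if "x \<in> truncation n - {root}" for x
    using that extends_to_height[of x n] by (auto simp: truncation_def)
qed

end

section \<open>Euclidean geometry\<close>

text \<open>Being joined by a bound that is uniform in the family is an equivalence relation with open
  classes, so connectedness joins any two points of \<open>X\<close>; by compactness the constants for
  finitely many pairs of points suffice. This replaces the mean value inequality on \<open>X\<close>, which need
  not be convex.\<close>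

lemma compact_connected_uniform_bound:
  fixes f :: "'i \<Rightarrow> 'a::metric_space \<Rightarrow> 'b::metric_space"
  assumes "compact X" "connected X" "\<delta> > 0"
    and loc: "\<And>i x y. \<lbrakk>i \<in> I; x \<in> X; y \<in> X; dist x y < \<delta>\<rbrakk> \<Longrightarrow> dist (f i x) (f i y) \<le> w i"
  shows "\<exists>C. \<forall>i\<in>I. \<forall>x\<in>X. \<forall>y\<in>X. dist (f i x) (f i y) \<le> C * w i"
proof -
  define R where "R x y \<longleftrightarrow> (\<exists>C. \<forall>i\<in>I. dist (f i x) (f i y) \<le> C * w i)" for x y
  have R: "R x y" if "x \<in> X" "y \<in> X" for x y
  proof (rule connected_equivalence_relation[OF \<open>connected X\<close> that])
    show "R y x" if "R x y" for x y
      using that by (simp add: R_def dist_commute)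
    show "R x z" if xy: "R x y" and yz: "R y z" for x y z
    proof -
      obtain C D where C: "\<And>i. i \<in> I \<Longrightarrow> dist (f i x) (f i y) \<le> C * w i"
        and D: "\<And>i. i \<in> I \<Longrightarrow> dist (f i y) (f i z) \<le> D * w i"
        using xy yz unfolding R_def by blast
      have "dist (f i x) (f i z) \<le> (C + D) * w i" if "i \<in> I" for i
        using C[OF that] D[OF that] dist_triangle[of "f i x" "f i z" "f i y"]
        by (simp add: algebra_simps)
      then show ?thesis
        unfolding R_def by blast
    qed
    show "\<exists>T. openin (top_of_set X) T \<and> a \<in> T \<and> (\<forall>x\<in>T. R a x)" if "a \<in> X" for a
    proof (intro exI conjI ballI)
      show "openin (top_of_set X) (X \<inter> ball a \<delta>)"
        by (simp add: openin_open_Int)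
      show "a \<in> X \<inter> ball a \<delta>"
        using that \<open>\<delta> > 0\<close> by simp
      show "R a x" if "x \<in> X \<inter> ball a \<delta>" for x
        unfolding R_def using that \<open>a \<in> X\<close> loc by (intro exI[of _ 1]) auto
    qed
  qed
  have "X \<subseteq> (\<Union>a\<in>X. ball a \<delta>)"
    using \<open>\<delta> > 0\<close> by auto
  then obtain F where F: "F \<subseteq> X" "finite F" "X \<subseteq> (\<Union>a\<in>F. ball a \<delta>)"
    using compactE_image[OF \<open>compact X\<close>, of X "\<lambda>a. ball a \<delta>"] by auto
  obtain C where C: "\<And>a b i. \<lbrakk>a \<in> X; b \<in> X; i \<in> I\<rbrakk> \<Longrightarrow> dist (f i a) (f i b) \<le> C a b * w i"
    using R unfolding R_def by metis
  define M where "M = (\<Sum>(a, b)\<in>F \<times> F. \<bar>C a b\<bar>)"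
  have "dist (f i x) (f i y) \<le> (M + 2) * w i" if "i \<in> I" "x \<in> X" "y \<in> X" for i x y
  proof -
    obtain a b where ab: "a \<in> F" "dist a x < \<delta>" "b \<in> F" "dist b y < \<delta>"
      using subsetD[OF F(3) \<open>x \<in> X\<close>] subsetD[OF F(3) \<open>y \<in> X\<close>] by auto
    have w: "0 \<le> w i"
      using loc[OF \<open>i \<in> I\<close> \<open>x \<in> X\<close> \<open>x \<in> X\<close>] \<open>\<delta> > 0\<close> by simp
    have "C a b \<le> M"
    proof -
      have "\<bar>C a b\<bar> \<le> M"
        unfolding M_def using member_le_sum[of "(a, b)" "F \<times> F" "\<lambda>(a, b). \<bar>C a b\<bar>"] ab F(2) by auto
      then show ?thesis by simp
    qed
    then have "dist (f i a) (f i b) \<le> M * w i"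
      using C[of a b i] ab F(1) \<open>i \<in> I\<close> mult_right_mono[OF _ w] by (meson order_trans subsetD)
    moreover have "dist (f i x) (f i a) \<le> w i" "dist (f i b) (f i y) \<le> w i"
      using loc that ab F(1) by (auto simp: dist_commute)
    ultimately have "dist (f i x) (f i y) \<le> w i + M * w i + w i"
      using dist_triangle[of "f i x" "f i y" "f i a"] dist_triangle[of "f i a" "f i y" "f i b"]
      by linarith
    then show ?thesis
      by (simp add: algebra_simps)
  qed
  then show ?thesis
    by blast
qed

text \<open>Near a frontier point a ball fits into the cone; any other point of \<open>X\<close> is the centre of a
  ball in \<open>X\<close> or has a frontier point close to it.\<close>

lemma cone_condition_inner_balls:
  fixes X :: "'a::euclidean_space set"
  assumes "0 < \<alpha>" "\<alpha> < pi" "0 < l"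
    and cone: "\<And>x. x \<in> frontier X \<Longrightarrow> \<exists>v. norm v = 1 \<and> open_cone x \<alpha> l v \<subseteq> interior X"
  obtains c where "c > 0"
    "\<And>x \<rho>. \<lbrakk>x \<in> X; 0 < \<rho>; \<rho> \<le> l\<rbrakk> \<Longrightarrow> \<exists>y. dist x y \<le> \<rho> \<and> ball y (c * \<rho>) \<subseteq> interior X"
proof -
  define k where "k = max (cos \<alpha>) 0"
  have "cos \<alpha> < 1"
    using cos_monotone_0_pi[of 0 \<alpha>] assms by simp
  then have k: "0 \<le> k" "k < 1" "cos \<alpha> \<le> k"
    by (auto simp: k_def)
  (* \<rho> v + u with norm u < c \<rho> must stay in the cone, that is, k (1 + c) < 1 - c *)
  define c where "c = (1 - k) / 4"
  have c: "0 < c" "c \<le> 1 / 4" "k * (1 + c) < 1 - c"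
  proof -
    have "c * (1 + k) \<le> c * 2"
      using k by (intro mult_left_mono) (auto simp: c_def)
    moreover have "c * 2 < 1 - k"
      using k by (simp add: c_def)
    ultimately show "k * (1 + c) < 1 - c"
      by (simp add: algebra_simps)
  qed (use k in \<open>auto simp: c_def\<close>)
  have frontier: "\<exists>y. dist x y \<le> \<rho> \<and> ball y (c * \<rho>) \<subseteq> interior X"
    if x: "x \<in> frontier X" and \<rho>: "0 < \<rho>" "\<rho> \<le> l / 2" for x \<rho>
  proof -
    obtain v where v: "norm v = 1" "open_cone x \<alpha> l v \<subseteq> interior X"
      using cone[OF x] by blast
    have "z \<in> open_cone x \<alpha> l v" if z: "z \<in> ball (x + \<rho> *\<^sub>R v) (c * \<rho>)" for z
    proof -
      define u where "u = z - (x + \<rho> *\<^sub>R v)"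
      have u: "norm u < c * \<rho>"
        using z by (simp add: u_def dist_norm norm_minus_commute)
      have zx: "z - x = \<rho> *\<^sub>R v + u"
        by (simp add: u_def)
      have c\<rho>: "c * \<rho> \<le> 1 / 4 * \<rho>"
        using c \<rho> by (intro mult_right_mono) auto
      have up: "norm (z - x) < (1 + c) * \<rho>"
        unfolding zx using norm_triangle_ineq[of "\<rho> *\<^sub>R v" u] u v \<rho> by (simp add: algebra_simps)
      have "\<bar>u \<bullet> v\<bar> \<le> norm u"
        using Cauchy_Schwarz_ineq2[of u v] v by simp
      then have low: "(z - x) \<bullet> v > (1 - c) * \<rho>"
        unfolding zx using u v by (simp add: inner_add_left dot_square_norm algebra_simps)
      have "cos \<alpha> * norm (z - x) \<le> k * norm (z - x)"
        using k by (intro mult_right_mono) auto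
      also have "\<dots> \<le> k * ((1 + c) * \<rho>)"
        using up k by (intro mult_left_mono) auto
      also have "\<dots> \<le> (1 - c) * \<rho>"
        using c \<rho> mult_right_mono[of "k * (1 + c)" "1 - c" \<rho>] by (simp add: mult.assoc)
      finally have "cos \<alpha> * norm (z - x) < (z - x) \<bullet> v"
        using low by linarith
      moreover have "norm (z - x) < l"
        using up c\<rho> \<rho> distrib_right[of 1 c \<rho>] by linarith
      moreover have "(1 - c) * \<rho> > 0"
        using c \<rho> by simp
      then have "z - x \<noteq> 0"
        using low by auto
      ultimately show ?thesis
        by (simp add: open_cone_def)
    qed
    then show ?thesis
      using v \<rho> by (intro exI[of _ "x + \<rho> *\<^sub>R v"]) (auto simp: dist_norm)
  qed
  have all: "\<exists>y. dist x y \<le> \<rho> \<and> ball y (c / 2 * \<rho>) \<subseteq> interior X"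
    if x: "x \<in> X" and \<rho>: "0 < \<rho>" "\<rho> \<le> l" for x \<rho>
  proof (cases "ball x (\<rho> / 2) \<subseteq> X")
    case True
    then have "ball x (\<rho> / 2) \<subseteq> interior X"
      by (simp add: interior_maximal)
    moreover have "ball x (c / 2 * \<rho>) \<subseteq> ball x (\<rho> / 2)"
      using c \<rho> by (intro subset_ball) simp
    ultimately show ?thesis
      using \<rho> by (intro exI[of _ x]) auto
  next
    case False
    have "x \<in> ball x (\<rho> / 2) \<inter> X"
      using x \<rho> by simp
    then have "ball x (\<rho> / 2) \<inter> frontier X \<noteq> {}"
      by (intro connected_Int_frontier connected_ball) (use False in blast)+
    then obtain x' where x': "dist x x' < \<rho> / 2" "x' \<in> frontier X"
      by auto
    obtain y where "dist x' y \<le> \<rho> / 2" "ball y (c * (\<rho> / 2)) \<subseteq> interior X"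
      using frontier[OF x'(2), of "\<rho> / 2"] \<rho> by auto
    then show ?thesis
      using x'(1) dist_triangle[of x y x'] by (intro exI[of _ y]) auto
  qed
  show ?thesis
    using that[of "c / 2"] all c by auto
qed

lemma cone_condition_ray:
  fixes X :: "'a::euclidean_space set"
  assumes "0 < \<alpha>" "\<alpha> < pi" "0 < l"
    and cone: "\<And>x. x \<in> frontier X \<Longrightarrow> \<exists>v. norm v = 1 \<and> open_cone x \<alpha> l v \<subseteq> interior X"
    and "x \<in> X"
  obtains v e where "norm v = 1" "e > 0" "\<And>t. \<lbrakk>0 < t; t < e\<rbrakk> \<Longrightarrow> x + t *\<^sub>R v \<in> X"
proof (cases "x \<in> interior X")
  case True
  then obtain e where e: "e > 0" "ball x e \<subseteq> X"
    using mem_interior by blast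
  obtain v :: 'a where v: "norm v = 1"
    using vector_choose_size[of 1] by auto
  show ?thesis
    using e v by (intro that[of v e]) (auto simp: dist_norm subset_iff)
next
  case False
  then have "x \<in> frontier X"
    using \<open>x \<in> X\<close> closure_subset by (auto simp: frontier_def)
  then obtain v where v: "norm v = 1" "open_cone x \<alpha> l v \<subseteq> interior X"
    using cone by blast
  have "cos \<alpha> < 1"
    using cos_monotone_0_pi[of 0 \<alpha>] assms by simp
  then have "x + t *\<^sub>R v \<in> open_cone x \<alpha> l v" if "0 < t" "t < l" for t
    using that v by (auto simp: open_cone_def dot_square_norm)
  then show ?thesis
    using v \<open>0 < l\<close> interior_subset by (intro that[of v l]) blast+
qed

lemma norm_derivative_le_along_ray:
  fixes f :: "'a::real_normed_vector \<Rightarrow> 'b::real_normed_vector"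
  assumes der: "(f has_derivative f') (at x)" and "e > 0"
    and ray: "\<And>t. \<lbrakk>0 < t; t < e\<rbrakk> \<Longrightarrow> norm (f (x + t *\<^sub>R v) - f x) \<le> s * t"
  shows "norm (f' v) \<le> s"
proof -
  have "((\<lambda>t. f (x + t *\<^sub>R v)) has_derivative (\<lambda>t. f' (t *\<^sub>R v))) (at 0)"
    by (rule has_derivative_compose[where g = f and f = "\<lambda>t. x + t *\<^sub>R v", simplified])
      (auto intro!: derivative_eq_intros der)
  then have "((\<lambda>t. norm (f (x + t *\<^sub>R v) - f x - f' (t *\<^sub>R v)) / norm t) \<longlongrightarrow> 0) (at 0)"
    by (simp add: has_derivative_at)
  then have lim: "((\<lambda>t. norm (f (x + t *\<^sub>R v) - f x - f' (t *\<^sub>R v)) / norm t) \<longlongrightarrow> 0) (at_right 0)"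
    by (rule tendsto_mono[rotated]) (simp add: at_le)
  have "\<forall>\<^sub>F t in at_right 0.
      norm (f' v) - s \<le> norm (f (x + t *\<^sub>R v) - f x - f' (t *\<^sub>R v)) / norm t"
    using eventually_at_right_real[OF \<open>e > 0\<close>]
  proof eventually_elim
    case (elim t)
    have "t * norm (f' v) = norm (f' (t *\<^sub>R v))"
      using has_derivative_linear[OF der] elim by (simp add: linear_scale)
    also have "\<dots> \<le> norm (f (x + t *\<^sub>R v) - f x) + norm (f (x + t *\<^sub>R v) - f x - f' (t *\<^sub>R v))"
      using norm_triangle_sub norm_minus_commute
        norm_triangle_ineq4[of "f (x + t *\<^sub>R v) - f x" "f (x + t *\<^sub>R v) - f x - f' (t *\<^sub>R v)"]
      by simp
    finally show ?case
      using ray[of t] elim by (simp add: field_simps)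
  qed
  then have "norm (f' v) - s \<le> 0"
    by (intro tendsto_lowerbound[OF lim]) (auto simp: trivial_limit_at_right_real)
  then show ?thesis
    by simp
qed

text \<open>The inverse contracts distances by \<open>1 / m\<close> wherever it is defined on a ball around \<open>f y\<close>. At
  the point of the complement of the image closest to \<open>f y\<close>, this would place a limit of image points
  in the image of a smaller closed ball, which is compact; so the closest point is far away.\<close>

lemma ball_subset_image_if_expanding:
  fixes f :: "'a::euclidean_space \<Rightarrow> 'a"
  assumes "R > 0" "m > 0" and inj: "inj_on f (ball y R)"
    and der: "\<And>x. x \<in> ball y R \<Longrightarrow> (f has_derivative f' x) (at x)"
    and exp: "\<And>x h. x \<in> ball y R \<Longrightarrow> m * norm h \<le> norm (f' x h)"
  shows "ball (f y) (m * R) \<subseteq> f ` ball y R"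
proof (rule ccontr)
  let ?S = "ball y R" and ?W = "f ` ball y R"
  assume "\<not> ?thesis"
  then obtain w where w: "w \<in> ball (f y) (m * R)" "w \<in> - ?W"
    by blast
  have cont: "continuous_on ?S f"
    using der by (meson continuous_at_imp_continuous_on has_derivative_continuous)
  have "open ?W"
    using invariance_of_domain[OF cont _ inj] by simp
  then obtain u where u: "u \<in> - ?W" "\<And>z. z \<in> - ?W \<Longrightarrow> dist (f y) u \<le> dist (f y) z"
    using distance_attains_inf[of "- ?W" "f y"] w(2) by auto
  define D where "D = dist (f y) u"
  have "f y \<in> ?W"
    using \<open>R > 0\<close> by simp
  then have "D > 0"
    using u(1) by (auto simp: D_def)
  have "D < m * R"
    using u(2)[OF w(2)] w(1) by (simp add: D_def)
  have ball_W: "ball (f y) D \<subseteq> ?W"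
  proof
    fix z assume "z \<in> ball (f y) D"
    then show "z \<in> ?W"
      using u(2)[of z] by (force simp: D_def)
  qed
  obtain g where g: "homeomorphism ?S ?W f g"
    using invariance_of_domain_homeomorphism[OF _ cont _ inj] by auto
  then have gf: "\<And>x. x \<in> ?S \<Longrightarrow> g (f x) = x" and fg: "\<And>z. z \<in> ?W \<Longrightarrow> f (g z) = z"
    and gW: "\<And>z. z \<in> ?W \<Longrightarrow> g z \<in> ?S"
    and contg: "continuous_on ?W g"
    unfolding homeomorphism_def by blast+
  have "\<exists>g'. (g has_derivative g') (at z) \<and> onorm g' \<le> 1 / m" if "z \<in> ?W" for z
  proof -
    have lin: "linear (f' (g z))"
      using der[OF gW[OF that]] has_derivative_linear by blast
    have "inj (f' (g z))"
    proof -
      have "x = 0" if "f' (g z) x = 0" for x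
        using exp[OF gW[OF \<open>z \<in> ?W\<close>], of x] \<open>m > 0\<close> that by (simp add: mult_le_0_iff)
      then show ?thesis
        using linear_injective_0[OF lin] by blast
    qed
    then obtain g' where g': "linear g'" "\<And>h. g' (f' (g z) h) = h" "\<And>h. f' (g z) (g' h) = h"
      using linear_injective_isomorphism[OF lin] by blast
    have "(g has_derivative g') (at z)"
    proof (rule has_derivative_inverse_basic[where f = f and f' = "f' (g z)"])
      show "(f has_derivative f' (g z)) (at (g z))"
        using der gW that by blast
      show "bounded_linear g'"
        using g'(1) linear_conv_bounded_linear by blast
      show "continuous (at z) g"
        using contg \<open>open ?W\<close> that continuous_on_eq_continuous_at by blast
      show "g' \<circ> f' (g z) = id"
        using g' by auto
    qed (use \<open>open ?W\<close> that fg in auto)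
    moreover have "onorm g' \<le> 1 / m"
    proof (rule onorm_bound)
      show "norm (g' h) \<le> 1 / m * norm h" for h
        using exp[OF gW[OF that], of "g' h"] g'(3) \<open>m > 0\<close> by (simp add: field_simps)
    qed (use \<open>m > 0\<close> in simp)
    ultimately show ?thesis
      by blast
  qed
  then obtain g' where g': "\<And>z. z \<in> ?W \<Longrightarrow> (g has_derivative g' z) (at z)"
    "\<And>z. z \<in> ?W \<Longrightarrow> onorm (g' z) \<le> 1 / m"
    by metis
  have "ball (f y) D \<subseteq> f ` cball y (D / m)"
  proof
    fix z assume z: "z \<in> ball (f y) D"
    have "norm (g z - g (f y)) \<le> 1 / m * norm (z - f y)"
      using ball_W g' z \<open>D > 0\<close>
      by (intro differentiable_bound[of "ball (f y) D" g g'])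
        (auto intro!: has_derivative_at_withinI[OF g'(1)])
    also have "\<dots> \<le> 1 / m * D"
      using z \<open>m > 0\<close> by (intro mult_left_mono) (auto simp: dist_norm norm_minus_commute)
    finally have "g z \<in> cball y (D / m)"
      using gf[of y] \<open>R > 0\<close> by (simp add: dist_norm norm_minus_commute)
    then show "z \<in> f ` cball y (D / m)"
      using fg[of z] ball_W z by (metis image_eqI subsetD)
  qed
  moreover have sub: "cball y (D / m) \<subseteq> ?S"
    using \<open>D < m * R\<close> \<open>m > 0\<close> by (auto simp: field_simps dist_norm)
      (smt (verit) mult.commute mult_less_cancel_right_pos pos_le_divide_eq)
  have "closed (f ` cball y (D / m))"
    using continuous_on_subset[OF cont sub] compact_continuous_image compact_cball
      compact_imp_closed by blast
  ultimately have "closure (ball (f y) D) \<subseteq> f ` cball y (D / m)"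
    by (intro closure_minimal)
  moreover have "u \<in> closure (ball (f y) D)"
    using \<open>D > 0\<close> by (simp add: D_def)
  ultimately show False
    using u(1) sub by blast
qed

text \<open>Comparison of volumes.\<close>

lemma disjoint_balls_card_bound:
  fixes c :: "'i \<Rightarrow> 'a::euclidean_space"
  assumes "finite P" "a > 0" "b \<ge> 0"
    and disj: "\<And>p q. \<lbrakk>p \<in> P; q \<in> P; p \<noteq> q\<rbrakk> \<Longrightarrow> ball (c p) a \<inter> ball (c q) a = {}"
    and inside: "\<And>p. p \<in> P \<Longrightarrow> ball (c p) a \<subseteq> ball z b"
  shows "real (card P) \<le> (b / a) ^ DIM('a)"
proof (cases "P = {}")
  case True
  then show ?thesis
    using assms by simp
next
  case False
  then obtain p where "p \<in> P" by blast
  have "b > 0"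
  proof (rule ccontr)
    assume "\<not> b > 0"
    then have "ball z b = {}" by simp
    then show False
      using inside[OF \<open>p \<in> P\<close>] \<open>a > 0\<close> by (metis centre_in_ball empty_iff subsetD)
  qed
  have "real (card P) * (unit_ball_vol (DIM('a)) * a ^ DIM('a)) = (\<Sum>p\<in>P. measure lborel (ball (c p) a))"
    using \<open>a > 0\<close> by (simp add: content_ball)
  also have "\<dots> = measure lborel (\<Union>p\<in>P. ball (c p) a)"
    using disj \<open>finite P\<close> emeasure_bounded_finite[OF bounded_ball]
    by (intro measure_finite_Union[symmetric]) (auto simp: disjoint_family_on_def top.not_eq_extremum)
  also have "\<dots> \<le> measure lborel (ball z b)"
    using inside \<open>finite P\<close> emeasure_bounded_finite[OF bounded_ball, of z b]
    by (intro measure_mono_fmeasurable) (auto simp: fmeasurable_def)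
  also have "\<dots> = unit_ball_vol (DIM('a)) * b ^ DIM('a)"
    using \<open>b > 0\<close> by (simp add: content_ball)
  finally show ?thesis
    using \<open>a > 0\<close> by (simp add: field_simps power_divide)
qed

section \<open>The maps of a tree iterated function system\<close>

lemma (in rooted_tree) tree_induct [consumes 1, case_names root step]:
  assumes "\<tau> \<in> T" "P root"
    and step: "\<And>\<tau>. \<lbrakk>\<tau> \<in> T; \<tau> \<noteq> root; P (parent \<tau>)\<rbrakk> \<Longrightarrow> P \<tau>"
  shows "P \<tau>"
  using assms(1)
proof (induction "height \<tau>" arbitrary: \<tau> rule: less_induct)
  case less
  show ?case
  proof (cases "\<tau> = root")
    case False
    have "P (parent \<tau>)"
      using less False parent_in[of \<tau>] height_parent[of \<tau>] by auto
    then show ?thesis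
      using step less False by blast
  qed (use \<open>P root\<close> in simp)
qed

context TIFS
begin

lemma \<Phi>_root [simp]: "\<Phi> root = id"
  by (simp add: \<Phi>_def)

lemma \<Phi>_parent:
  assumes "\<tau> \<in> T" "\<tau> \<noteq> root"
  shows "\<Phi> \<tau> = \<Phi> (parent \<tau>) \<circ> \<phi> \<tau>"
proof -
  define n where "n = height (parent \<tau>)"
  have h: "height \<tau> = Suc n"
    using height_parent[OF assms] by (simp add: n_def)
  have append: "foldr (\<circ>) (fs @ [f]) id = foldr (\<circ>) fs id \<circ> f" for fs and f :: "'a \<Rightarrow> 'a"
    by (induction fs) (auto simp: comp_assoc)
  have "restriction \<tau> k = restriction (parent \<tau>) k" if "k < n + 1" for k
    using restriction_of_below[OF assms(1) parent_in[OF assms] parent_le[OF assms]] that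
    by (simp add: n_def)
  moreover have "restriction \<tau> (Suc n) = \<tau>"
    using restriction_eqI[OF assms(1,1) tree_refl[OF assms(1)] h] .
  ultimately have "map (\<lambda>k. \<phi> (restriction \<tau> k)) [1..<height \<tau> + 1]
      = map (\<lambda>k. \<phi> (restriction (parent \<tau>) k)) [1..<n + 1] @ [\<phi> \<tau>]"
    by (auto simp: h)
  then show ?thesis
    unfolding \<Phi>_def by (simp only: append n_def)
qed

lemma \<Phi>_maps_X: "\<tau> \<in> T \<Longrightarrow> \<Phi> \<tau> ` X \<subseteq> X"
proof (induction rule: tree_induct)
  case (step \<tau>)
  then show ?case
    using phi_maps[of \<tau>] by (auto simp: \<Phi>_parent)
qed simp

lemma \<Phi>_parent_image: "\<lbrakk>\<tau> \<in> T; \<tau> \<noteq> root\<rbrakk> \<Longrightarrow> \<Phi> \<tau> ` X \<subseteq> \<Phi> (parent \<tau>) ` X"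
  using phi_maps[of \<tau>] by (auto simp: \<Phi>_parent)

lemma \<Phi>_contracts:
  assumes "\<And>\<tau>. \<tau> \<in> T - {root} \<Longrightarrow> s-lipschitz_on X (\<phi> \<tau>)" "\<tau> \<in> T" "s \<ge> 0"
  shows "(s ^ height \<tau>)-lipschitz_on X (\<Phi> \<tau>)"
  using assms(2)
proof (induction rule: tree_induct)
  case root
  then show ?case
    by (simp add: lipschitz_on_def)
next
  case (step \<tau>)
  have "(s ^ height (parent \<tau>) * s)-lipschitz_on X (\<Phi> (parent \<tau>) \<circ> \<phi> \<tau>)"
    using step phi_maps[of \<tau>] by (intro lipschitz_on_compose assms(1) lipschitz_on_subset[OF step(3)]) auto
  then show ?case
    using height_parent[OF step(1,2)] by (simp add: \<Phi>_parent step mult.commute flip: power_Suc)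
qed

end

section \<open>Conformal maps and their derivatives\<close>

text \<open>All that is used of conformality: the derivative scales every vector by the same factor,
  so that the factors of a composition multiply exactly.\<close>

definition similarity_at :: "('a::euclidean_space \<Rightarrow> 'a) \<Rightarrow> 'a \<Rightarrow> bool" where
  "similarity_at f x \<longleftrightarrow>
     (\<exists>f' c. 0 < c \<and> (f has_derivative f') (at x) \<and> (\<forall>h. norm (f' h) = c * norm h))"

lemma deriv_norm_eqI:
  fixes f :: "'a::euclidean_space \<Rightarrow> 'a"
  assumes "(f has_derivative f') (at x)" "\<And>h. norm (f' h) = c * norm h"
  shows "deriv_norm f x = c"
proof -
  obtain v :: 'a where "norm v = 1"
    using vector_choose_size[of 1] by auto
  then have "onorm f' = c"
    using assms(2) onorm_le[of f' c] le_onorm[OF has_derivative_bounded_linear[OF assms(1)], of v]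
    by (intro antisym) auto
  then show ?thesis
    using frechet_derivative_at[OF assms(1)] by (simp add: deriv_norm_def)
qed

lemma similarity_atD:
  assumes "similarity_at f x"
  shows "0 < deriv_norm f x"
    and "(f has_derivative frechet_derivative f (at x)) (at x)"
    and "norm (frechet_derivative f (at x) h) = deriv_norm f x * norm h"
  using assms deriv_norm_eqI frechet_derivative_at unfolding similarity_at_def by metis+

lemma similarity_at_compose:
  assumes "similarity_at g x" "similarity_at f (g x)"
  shows "similarity_at (f \<circ> g) x"
    and "deriv_norm (f \<circ> g) x = deriv_norm f (g x) * deriv_norm g x"
proof -
  have der: "(f \<circ> g has_derivative frechet_derivative f (at (g x)) \<circ> frechet_derivative g (at x)) (at x)"
    using assms similarity_atD(2) by (intro diff_chain_at)
  have norm: "norm ((frechet_derivative f (at (g x)) \<circ> frechet_derivative g (at x)) h)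
      = (deriv_norm f (g x) * deriv_norm g x) * norm h" for h
    using similarity_atD(3)[OF assms(1)] similarity_atD(3)[OF assms(2)] by simp
  show "deriv_norm (f \<circ> g) x = deriv_norm f (g x) * deriv_norm g x"
    using der norm by (rule deriv_norm_eqI)
  have "0 < deriv_norm f (g x) * deriv_norm g x"
    using assms similarity_atD(1) by (intro mult_pos_pos)
  then show "similarity_at (f \<circ> g) x"
    unfolding similarity_at_def using der norm by blast
qed

lemma conformal_on_similarity_at:
  assumes "conformal_on V f" "x \<in> V"
  shows "similarity_at f x"
proof -
  obtain c Q where "c \<noteq> 0" "orthogonal_transformation Q"
    "(f has_derivative (\<lambda>h. c *\<^sub>R Q h)) (at x)"
    using assms unfolding conformal_on_def by blast
  then show ?thesis
    unfolding similarity_at_def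
    by (intro exI[of _ "\<lambda>h. c *\<^sub>R Q h"] exI[of _ "\<bar>c\<bar>"]) (simp add: orthogonal_transformation_norm)
qed

context conformal_TIFS
begin

text \<open>Compactness puts a point into all the nested images, contraction makes it the only one, and so
  \<open>the_elem\<close> in the definition of \<open>coding\<close> returns it.\<close>

lemma coding_in_image:
  assumes \<omega>: "\<omega> \<in> infinite_paths"
  shows "coding \<omega> \<in> \<Phi> (\<omega> n) ` X"
proof -
  obtain s where s: "0 < s" "s < 1" "\<And>\<tau>. \<tau> \<in> T - {root} \<Longrightarrow> s-lipschitz_on X (\<phi> \<tau>)"
    using phi_contracts by blast
  note lip = \<Phi>_contracts[OF s(3) infinite_pathD(1)[OF \<omega>] less_imp_le[OF s(1)]]
  define F where "F n = \<Phi> (\<omega> n) ` X" for n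
  have comp: "compact (F n)" for n
    unfolding F_def using lipschitz_on_continuous_on[OF lip[of n]] s X_compact
    by (intro compact_continuous_image) auto
  have dec: "F (Suc n) \<subseteq> F n" for n
    unfolding F_def using \<Phi>_parent_image infinite_pathD[OF \<omega>] by metis
  have "\<Inter>(range F) \<noteq> {}"
    using comp X_nonempty lift_Suc_antimono_le[of F, OF dec]
    by (intro compact_nest) (simp_all add: F_def)
  then obtain p where p: "\<And>n. p \<in> F n"
    by blast
  have "q = p" if q: "\<And>n. n \<ge> 1 \<Longrightarrow> q \<in> F n" for q
  proof -
    have "dist q p \<le> s ^ n * diameter X" if n: "n \<ge> 1" for n
    proof -
      obtain x y where xy: "x \<in> X" "y \<in> X" "q = \<Phi> (\<omega> n) x" "p = \<Phi> (\<omega> n) y"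
        using q[OF n] p[of n] by (auto simp: F_def)
      have "dist q p \<le> s ^ n * dist x y"
        using lipschitz_onD[OF lip xy(1,2)] xy s infinite_pathD(2)[OF \<omega>] by simp
      also have "\<dots> \<le> s ^ n * diameter X"
        using s xy diameter_bounded_bound[OF compact_imp_bounded[OF X_compact]]
        by (intro mult_left_mono) auto
      finally show ?thesis .
    qed
    moreover have "(\<lambda>n. s ^ n * diameter X) \<longlonglongrightarrow> 0"
      using s by (intro tendsto_mult_left_zero LIMSEQ_realpow_zero) auto
    ultimately have "dist q p \<le> 0"
      using eventually_sequentiallyI[of 1 "\<lambda>n. dist q p \<le> s ^ n * diameter X"]
      by (intro tendsto_lowerbound[of "\<lambda>n. s ^ n * diameter X"]) auto
    then show ?thesis
      by simp
  qed
  then have "(\<Inter>n\<in>{1..}. F n) = {p}"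
    using p by auto
  then show ?thesis
    using p unfolding coding_def F_def by simp
qed

lemma phi_similarity_at: "\<lbrakk>\<tau> \<in> T; \<tau> \<noteq> root; x \<in> V\<rbrakk> \<Longrightarrow> similarity_at (\<phi> \<tau>) x"
  using phi_conformal conformal_on_similarity_at by blast

lemma \<Phi>_similarity_at:
  assumes "\<tau> \<in> T" "x \<in> V"
  shows "similarity_at (\<Phi> \<tau>) x"
  using assms
proof (induction arbitrary: x rule: tree_induct)
  case root
  then show ?case
    unfolding similarity_at_def
    by (intro exI[of _ id] exI[of _ "1::real"]) (auto simp: id_def intro: derivative_eq_intros)
next
  case (step \<tau>)
  then show ?case
    unfolding \<Phi>_parent[OF step(1,2)] using phi_maps_V[of \<tau>]
    by (intro similarity_at_compose(1) phi_similarity_at) auto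
qed

lemma phi_inj_on: "\<lbrakk>\<tau> \<in> T; \<tau> \<noteq> root\<rbrakk> \<Longrightarrow> inj_on (\<phi> \<tau>) V"
  using phi_diffeo[of \<tau>] unfolding C1_diffeo_onto_image_def by (metis Diff_iff inj_on_inverseI singletonD)

lemma \<Phi>_inj_on: "\<tau> \<in> T \<Longrightarrow> inj_on (\<Phi> \<tau>) V"
proof (induction rule: tree_induct)
  case (step \<tau>)
  then have "inj_on (\<Phi> (parent \<tau>) \<circ> \<phi> \<tau>) V"
    using phi_maps_V[of \<tau>] by (intro comp_inj_on phi_inj_on inj_on_subset[OF step(3)]) auto
  then show ?case
    unfolding \<Phi>_parent[OF step(1,2)] .
qed simp

text \<open>By invariance of domain, the image of the interior is an open subset of \<open>X\<close>.\<close>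

lemma phi_interior:
  assumes "\<tau> \<in> T" "\<tau> \<noteq> root"
  shows "\<phi> \<tau> ` interior X \<subseteq> interior X"
proof (rule interior_maximal)
  show "\<phi> \<tau> ` interior X \<subseteq> X"
    using phi_maps[of \<tau>] assms interior_subset by blast
  have sub: "interior X \<subseteq> V"
    using X_subset_V interior_subset by blast
  have "continuous_on (interior X) (\<phi> \<tau>)"
    using phi_similarity_at[OF assms] similarity_atD(2) has_derivative_continuous sub
    by (meson continuous_at_imp_continuous_on subsetD)
  then show "open (\<phi> \<tau> ` interior X)"
    using inj_on_subset[OF phi_inj_on[OF assms] sub] by (intro invariance_of_domain) auto
qed

text \<open>Induction on the height: nodes with different parents inherit disjointness from the parents,
  siblings from the open set condition and the injectivity of the parent's map.\<close>

lemma \<Phi>_interiors_disjoint: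
  assumes "\<tau> \<in> T" "\<sigma> \<in> T" "height \<sigma> = height \<tau>" "\<sigma> \<noteq> \<tau>"
  shows "\<Phi> \<tau> ` interior X \<inter> \<Phi> \<sigma> ` interior X = {}"
  using assms
proof (induction arbitrary: \<sigma> rule: tree_induct)
  case root
  then show ?case
    using height_eq_0_iff by simp
next
  case (step \<tau>)
  have \<sigma>: "\<sigma> \<noteq> root"
    using step height_eq_0_iff[of \<tau>] by auto
  note ph = parent_in[OF step(1,2)] parent_in[OF step(4) \<sigma>]
  have heights: "height (parent \<sigma>) = height (parent \<tau>)"
    using height_parent[OF step(1,2)] height_parent[OF step(4) \<sigma>] step(5) by simp
  have int: "\<phi> \<tau> ` interior X \<subseteq> interior X" "\<phi> \<sigma> ` interior X \<subseteq> interior X"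
    using phi_interior step \<sigma> by auto
  show ?case
  proof (cases "parent \<sigma> = parent \<tau>")
    case True
    then have "\<phi> \<tau> ` interior X \<inter> \<phi> \<sigma> ` interior X = {}"
      using in_successors_parent[OF step(1,2)] in_successors_parent[OF step(4) \<sigma>] step(6) ph
      by (intro open_set_condition[of "parent \<tau>"]) auto
    moreover have "inj_on (\<Phi> (parent \<tau>)) (interior X)"
      using inj_on_subset[OF \<Phi>_inj_on[OF ph(1)]] X_subset_V interior_subset by blast
    ultimately have "\<Phi> (parent \<tau>) ` (\<phi> \<tau> ` interior X) \<inter> \<Phi> (parent \<tau>) ` (\<phi> \<sigma> ` interior X) = {}"
      using int inj_on_image_Int[of "\<Phi> (parent \<tau>)" "interior X"] by (metis image_empty)
    then show ?thesis
      using True step \<sigma> by (simp add: \<Phi>_parent image_comp)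
  next
    case False
    have "\<Phi> \<tau> ` interior X \<subseteq> \<Phi> (parent \<tau>) ` interior X"
      "\<Phi> \<sigma> ` interior X \<subseteq> \<Phi> (parent \<sigma>) ` interior X"
      using int step(1,2,4) \<sigma> by (auto simp: \<Phi>_parent)
    then show ?thesis
      using step(3)[OF ph(2) heights False] by blast
  qed
qed

lemma sup_deriv_norm_comparable:
  obtains K where "K \<ge> 1" "\<And>\<tau>. \<tau> \<in> T \<Longrightarrow> 0 < sup_deriv_norm \<tau>"
    "\<And>\<tau> x. \<lbrakk>\<tau> \<in> T; x \<in> V\<rbrakk> \<Longrightarrow> deriv_norm (\<Phi> \<tau>) x \<le> K * sup_deriv_norm \<tau>"
    "\<And>\<tau> x. \<lbrakk>\<tau> \<in> T; x \<in> V\<rbrakk> \<Longrightarrow> sup_deriv_norm \<tau> \<le> K * deriv_norm (\<Phi> \<tau>) x"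
    "\<And>\<tau> x. \<lbrakk>\<tau> \<in> T; x \<in> X\<rbrakk> \<Longrightarrow> deriv_norm (\<Phi> \<tau>) x \<le> sup_deriv_norm \<tau>"
proof -
  obtain K where K: "K \<ge> 1"
    "\<And>\<tau> x y. \<lbrakk>\<tau> \<in> T; x \<in> V; y \<in> V\<rbrakk> \<Longrightarrow> deriv_norm (\<Phi> \<tau>) x \<le> K * deriv_norm (\<Phi> \<tau>) y"
    using bounded_distortion by blast
  obtain x0 where x0: "x0 \<in> X"
    using X_nonempty by blast
  have up: "deriv_norm (\<Phi> \<tau>) x \<le> sup_deriv_norm \<tau>" if "\<tau> \<in> T" "x \<in> X" for \<tau> x
    unfolding sup_deriv_norm_def
  proof (rule cSUP_upper[OF \<open>x \<in> X\<close>])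
    show "bdd_above (deriv_norm (\<Phi> \<tau>) ` X)"
      using K(2)[OF \<open>\<tau> \<in> T\<close>] X_subset_V x0 by (intro bdd_aboveI2[of _ _ "K * deriv_norm (\<Phi> \<tau>) x0"]) auto
  qed
  show ?thesis
  proof (rule that[OF K(1)])
    show "0 < sup_deriv_norm \<tau>" if "\<tau> \<in> T" for \<tau>
      using up[OF that x0] similarity_atD(1)[OF \<Phi>_similarity_at[OF that]] X_subset_V x0
      by (meson order_less_le_trans subsetD)
    show "deriv_norm (\<Phi> \<tau>) x \<le> K * sup_deriv_norm \<tau>" if "\<tau> \<in> T" "x \<in> V" for \<tau> x
    proof -
      have "deriv_norm (\<Phi> \<tau>) x \<le> K * deriv_norm (\<Phi> \<tau>) x0"
        using K(2) that X_subset_V x0 by blast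
      also have "\<dots> \<le> K * sup_deriv_norm \<tau>"
        using up[OF that(1) x0] K(1) by (intro mult_left_mono) auto
      finally show ?thesis .
    qed
    show "sup_deriv_norm \<tau> \<le> K * deriv_norm (\<Phi> \<tau>) x" if "\<tau> \<in> T" "x \<in> V" for \<tau> x
      unfolding sup_deriv_norm_def
      by (rule cSUP_least) (use K(2) that X_subset_V X_nonempty in auto)
  qed (rule up)
qed

lemma sup_deriv_norm_pos: "\<tau> \<in> T \<Longrightarrow> 0 < sup_deriv_norm \<tau>"
  using sup_deriv_norm_comparable by metis

lemma sup_deriv_norm_root [simp]: "sup_deriv_norm root = 1"
proof -
  have "deriv_norm id x = 1" for x :: 'a
    by (rule deriv_norm_eqI[of _ id]) (auto simp: id_def)
  then show ?thesis
    using X_nonempty by (simp add: sup_deriv_norm_def)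
qed

text \<open>The Lipschitz constant on \<open>X\<close> bounds the derivative only in directions in which \<open>X\<close> contains
  a ray; the cone condition provides one such direction, and one suffices for a conformal map.\<close>

lemma sup_deriv_norm_parent:
  assumes "s-lipschitz_on X (\<phi> \<tau>)" "\<tau> \<in> T" "\<tau> \<noteq> root"
  shows "sup_deriv_norm \<tau> \<le> s * sup_deriv_norm (parent \<tau>)"
proof -
  obtain \<alpha> l where cone: "0 < \<alpha>" "\<alpha> < pi" "0 < l"
    "\<And>x. x \<in> frontier X \<Longrightarrow> \<exists>v. norm v = 1 \<and> open_cone x \<alpha> l v \<subseteq> interior X"
    using cone_condition by blast
  have "deriv_norm (\<Phi> \<tau>) x \<le> s * sup_deriv_norm (parent \<tau>)" if x: "x \<in> X" for x
  proof -
    obtain v e where v: "norm v = 1" "e > 0" "\<And>t. \<lbrakk>0 < t; t < e\<rbrakk> \<Longrightarrow> x + t *\<^sub>R v \<in> X"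
      using cone_condition_ray[OF cone x] by blast
    have V: "x \<in> V"
      using x X_subset_V by blast
    note sim = similarity_atD[OF phi_similarity_at[OF assms(2,3) V]]
    have "norm (frechet_derivative (\<phi> \<tau>) (at x) v) \<le> s"
      using sim(2) v(2)
    proof (rule norm_derivative_le_along_ray)
      show "norm (\<phi> \<tau> (x + t *\<^sub>R v) - \<phi> \<tau> x) \<le> s * t" if "0 < t" "t < e" for t
        using lipschitz_on_normD[OF assms(1) v(3)[OF that] x] v(1) that by simp
    qed
    then have s: "deriv_norm (\<phi> \<tau>) x \<le> s"
      using sim(3)[of v] v(1) by simp
    have fx: "\<phi> \<tau> x \<in> X"
      using phi_maps[of \<tau>] assms x by blast
    have "deriv_norm (\<Phi> (parent \<tau>)) (\<phi> \<tau> x) \<le> sup_deriv_norm (parent \<tau>)"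
      using sup_deriv_norm_comparable parent_in[OF assms(2,3)] fx by metis
    then have "deriv_norm (\<Phi> (parent \<tau>)) (\<phi> \<tau> x) * deriv_norm (\<phi> \<tau>) x \<le> sup_deriv_norm (parent \<tau>) * s"
      using s sim(1) sup_deriv_norm_pos[OF parent_in[OF assms(2,3)]] by (intro mult_mono) auto
    then show ?thesis
      using similarity_at_compose(2)[OF phi_similarity_at[OF assms(2,3) V]
          \<Phi>_similarity_at[OF parent_in[OF assms(2,3)]], of] fx X_subset_V
      by (simp add: \<Phi>_parent[OF assms(2,3)] subset_iff mult.commute)
  qed
  then show ?thesis
    unfolding sup_deriv_norm_def[of \<tau>] using X_nonempty by (intro cSUP_least)
qed

lemma sup_deriv_norm_contracts:
  obtains s where "0 < s" "s < 1"
    "\<And>\<tau>. \<tau> \<in> T \<Longrightarrow> sup_deriv_norm \<tau> \<le> s ^ height \<tau>"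
proof -
  obtain s where s: "0 < s" "s < 1" "\<And>\<tau>. \<tau> \<in> T - {root} \<Longrightarrow> s-lipschitz_on X (\<phi> \<tau>)"
    using phi_contracts by blast
  have parent: "sup_deriv_norm \<tau> \<le> s * sup_deriv_norm (parent \<tau>)" if "\<tau> \<in> T" "\<tau> \<noteq> root" for \<tau>
    using sup_deriv_norm_parent s(3) that by blast
  have "sup_deriv_norm \<tau> \<le> s ^ height \<tau>" if "\<tau> \<in> T" for \<tau>
    using that
  proof (induction rule: tree_induct)
    case (step \<tau>)
    have "sup_deriv_norm \<tau> \<le> s * s ^ height (parent \<tau>)"
      using parent[OF step(1,2)] step(3) s(1)
      by (meson mult_left_mono less_imp_le order_trans)
    then show ?case
      using height_parent[OF step(1,2)] by (metis power_Suc)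
  qed simp
  then show ?thesis
    using that s by blast
qed

lemma \<Phi>_dist_le:
  obtains \<delta> C where "\<delta> > 0" "C > 0"
    "\<And>\<tau> x y. \<lbrakk>\<tau> \<in> T; x \<in> X; dist x y < \<delta>\<rbrakk>
      \<Longrightarrow> dist (\<Phi> \<tau> x) (\<Phi> \<tau> y) \<le> C * sup_deriv_norm \<tau> * dist x y"
proof -
  obtain K where K: "K \<ge> 1"
    "\<And>\<tau> x. \<lbrakk>\<tau> \<in> T; x \<in> V\<rbrakk> \<Longrightarrow> deriv_norm (\<Phi> \<tau>) x \<le> K * sup_deriv_norm \<tau>"
    using sup_deriv_norm_comparable by metis
  obtain \<delta> where \<delta>: "\<delta> > 0" "(\<Union>x\<in>X. ball x \<delta>) \<subseteq> V"
    using compact_subset_open_imp_ball_epsilon_subset[OF X_compact V_open X_subset_V] by blast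
  have "dist (\<Phi> \<tau> x) (\<Phi> \<tau> y) \<le> K * sup_deriv_norm \<tau> * dist x y"
    if "\<tau> \<in> T" "x \<in> X" "dist x y < \<delta>" for \<tau> x y
    unfolding dist_norm
  proof (rule differentiable_bound)
    fix z assume "z \<in> ball x \<delta>"
    then have "z \<in> V"
      using \<delta>(2) that(2) by blast
    then show "onorm (frechet_derivative (\<Phi> \<tau>) (at z)) \<le> K * sup_deriv_norm \<tau>"
      "(\<Phi> \<tau> has_derivative frechet_derivative (\<Phi> \<tau>) (at z)) (at z within ball x \<delta>)"
      using K(2)[OF that(1)] similarity_atD(2)[OF \<Phi>_similarity_at[OF that(1)]]
      by (auto simp: deriv_norm_def has_derivative_at_withinI)
  qed (use that \<delta>(1) in auto)
  then show ?thesis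
    using that[of \<delta> K] \<delta>(1) K(1) by auto
qed

lemma \<Phi>_diameter_le:
  obtains C where "C > 0" "\<And>\<tau>. \<tau> \<in> T \<Longrightarrow> diameter (\<Phi> \<tau> ` X) \<le> C * sup_deriv_norm \<tau>"
proof -
  obtain \<delta> C where \<delta>: "\<delta> > 0" "C > 0" and loc: "\<And>\<tau> x y. \<lbrakk>\<tau> \<in> T; x \<in> X; dist x y < \<delta>\<rbrakk>
      \<Longrightarrow> dist (\<Phi> \<tau> x) (\<Phi> \<tau> y) \<le> C * sup_deriv_norm \<tau> * dist x y"
    using \<Phi>_dist_le by metis
  have "\<exists>D. \<forall>\<tau>\<in>T. \<forall>x\<in>X. \<forall>y\<in>X. dist (\<Phi> \<tau> x) (\<Phi> \<tau> y) \<le> D * (C * sup_deriv_norm \<tau> * \<delta>)"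
    using X_compact X_connected \<delta>(1)
  proof (rule compact_connected_uniform_bound)
    show "dist (\<Phi> \<tau> x) (\<Phi> \<tau> y) \<le> C * sup_deriv_norm \<tau> * \<delta>"
      if "\<tau> \<in> T" "x \<in> X" "y \<in> X" "dist x y < \<delta>" for \<tau> x y
      using loc[OF that(1,2,4)] that(4) \<delta>(2) sup_deriv_norm_pos[OF that(1)]
      by (meson less_imp_le mult_left_mono mult_pos_pos order_trans)
  qed
  then obtain D where D: "\<And>\<tau> x y. \<lbrakk>\<tau> \<in> T; x \<in> X; y \<in> X\<rbrakk>
      \<Longrightarrow> dist (\<Phi> \<tau> x) (\<Phi> \<tau> y) \<le> D * (C * sup_deriv_norm \<tau> * \<delta>)"
    by blast
  have "diameter (\<Phi> \<tau> ` X) \<le> (\<bar>D\<bar> * C * \<delta> + 1) * sup_deriv_norm \<tau>" if "\<tau> \<in> T" for \<tau>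
  proof (rule diameter_le)
    fix p q assume "p \<in> \<Phi> \<tau> ` X" "q \<in> \<Phi> \<tau> ` X"
    then have "norm (p - q) \<le> D * (C * sup_deriv_norm \<tau> * \<delta>)"
      using D[OF that] by (auto simp: dist_norm)
    also have "\<dots> \<le> \<bar>D\<bar> * (C * sup_deriv_norm \<tau> * \<delta>) + sup_deriv_norm \<tau>"
      using \<delta> sup_deriv_norm_pos[OF that] by (intro order_trans[OF mult_right_mono[of D "\<bar>D\<bar>"]]) auto
    finally show "norm (p - q) \<le> (\<bar>D\<bar> * C * \<delta> + 1) * sup_deriv_norm \<tau>"
      by (simp add: algebra_simps)
  qed (use X_nonempty in auto)
  then show ?thesis
    using \<delta> by (intro that[of "\<bar>D\<bar> * C * \<delta> + 1"]) (auto intro: add_nonneg_pos)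
qed

section \<open>The sums over maximal antichains\<close>

lemma
  assumes "n \<ge> 1"
  shows finite_maximal_antichains:
      "finite {A. maximal_antichain_in (truncation n - {root}) (\<preceq>) A}"
    and Z_star_attained: "\<exists>A. maximal_antichain_in (truncation n - {root}) (\<preceq>) A
      \<and> Z_star n t = (\<Sum>\<omega>\<in>A. sup_deriv_norm \<omega> powr t)"
proof -
  have "{A. maximal_antichain_in (truncation n - {root}) (\<preceq>) A} \<subseteq> Pow (truncation n)"
    using maximal_antichainD by (fastforce simp: antichain_in_def)
  then show fin: "finite {A. maximal_antichain_in (truncation n - {root}) (\<preceq>) A}"
    using finite_truncation finite_subset by blast
  have "Z_star n t \<in> (\<lambda>A. \<Sum>\<omega>\<in>A. sup_deriv_norm \<omega> powr t) `
     {A. maximal_antichain_in (truncation n - {root}) (\<preceq>) A}"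
    unfolding Z_star_def using fin level_maximal_antichain[OF assms] by (intro Min_in) auto
  then show "\<exists>A. maximal_antichain_in (truncation n - {root}) (\<preceq>) A
      \<and> Z_star n t = (\<Sum>\<omega>\<in>A. sup_deriv_norm \<omega> powr t)"
    by blast
qed

lemma Z_star_le:
  assumes "n \<ge> 1" "maximal_antichain_in (truncation n - {root}) (\<preceq>) A"
  shows "Z_star n t \<le> (\<Sum>\<omega>\<in>A. sup_deriv_norm \<omega> powr t)"
  unfolding Z_star_def using assms finite_maximal_antichains by (intro Min_le) auto

lemma Z_star_nonneg: "n \<ge> 1 \<Longrightarrow> 0 \<le> Z_star n t"
  using Z_star_attained[of n t] by (auto simp: sum_nonneg)

lemma Z_star_Suc: "n \<ge> 1 \<Longrightarrow> Z_star (Suc n) t \<le> Z_star n t"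
  using Z_star_attained[of n t] Z_star_le maximal_antichain_truncation_Suc by fastforce

text \<open>Monotonicity starts at index \<open>1\<close>: for index \<open>0\<close> the only antichain is empty and the sum
  vanishes.\<close>

lemma Z_star_tendsto:
  shows "(\<lambda>n. Z_star n t) \<longlonglongrightarrow> Z_star_inf t" and "n \<ge> 1 \<Longrightarrow> Z_star_inf t \<le> Z_star n t"
proof -
  have dec: "decseq (\<lambda>n. Z_star (Suc n) t)"
    by (intro decseq_SucI Z_star_Suc) simp
  then obtain L where L: "(\<lambda>n. Z_star (Suc n) t) \<longlonglongrightarrow> L" "\<And>i. L \<le> Z_star (Suc i) t"
    using decseq_convergent[OF dec, of 0] Z_star_nonneg by auto
  from LIMSEQ_imp_Suc[OF L(1)] have "(\<lambda>n. Z_star n t) \<longlonglongrightarrow> L" .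
  moreover from this have "L = Z_star_inf t"
    unfolding Z_star_inf_def by (simp add: limI)
  ultimately show "(\<lambda>n. Z_star n t) \<longlonglongrightarrow> Z_star_inf t" "n \<ge> 1 \<Longrightarrow> Z_star_inf t \<le> Z_star n t"
    using L(2)[of "n - 1"] by auto
qed

lemma Z_star_inf_nonneg: "0 \<le> Z_star_inf t"
  by (rule tendsto_lowerbound[OF Z_star_tendsto(1)])
    (auto intro: eventually_sequentiallyI[of 1] Z_star_nonneg)

lemma Z_star_inf_le_sum:
  "\<lbrakk>n \<ge> 1; maximal_antichain_in (truncation n - {root}) (\<preceq>) A\<rbrakk>
    \<Longrightarrow> Z_star_inf t \<le> (\<Sum>\<omega>\<in>A. sup_deriv_norm \<omega> powr t)"
  using Z_star_tendsto(2) Z_star_le order_trans by blast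

lemma Z_star_inf_approximated:
  assumes "Z_star_inf t < e"
  obtains n A where "n \<ge> 1" "maximal_antichain_in (truncation n - {root}) (\<preceq>) A"
    "(\<Sum>\<omega>\<in>A. sup_deriv_norm \<omega> powr t) < e"
proof -
  have "\<forall>\<^sub>F n in sequentially. Z_star n t < e \<and> n \<ge> 1"
    using order_tendstoD(2)[OF Z_star_tendsto(1) assms] eventually_ge_at_top by (rule eventually_conj)
  then obtain n where "Z_star n t < e" "n \<ge> 1"
    using eventually_happens'[OF sequentially_bot] by blast
  then show ?thesis
    using that Z_star_attained[of n t] by metis
qed

end

section \<open>Counting cylinders at a given scale\<close>

context conformal_TIFS
begin

text \<open>A node \<open>p\<close> counted here may have an image much larger than \<open>r\<close>, so its whole image is of no use
  for a volume estimate. Instead a ball of radius comparable to \<open>r / sup_deriv_norm p\<close> is taken in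
  the interior of \<open>X\<close>, close to a point that \<open>\<Phi> p\<close> maps into \<open>U\<close>; its image contains a ball of
  radius comparable to \<open>r\<close> at distance comparable to \<open>r\<close> from \<open>U\<close>, and these balls are disjoint.\<close>

lemma large_images_card_bound:
  obtains M where "M \<ge> 0"
    "\<And>n r U. \<lbrakk>0 < r; bounded U; diameter U \<le> r\<rbrakk> \<Longrightarrow>
      real (card {p\<in>T. height p = n \<and> r < sup_deriv_norm p \<and> \<Phi> p ` X \<inter> U \<noteq> {}}) \<le> M"
proof -
  obtain K where K: "K \<ge> 1"
    "\<And>\<tau> x. \<lbrakk>\<tau> \<in> T; x \<in> V\<rbrakk> \<Longrightarrow> sup_deriv_norm \<tau> \<le> K * deriv_norm (\<Phi> \<tau>) x"
    using sup_deriv_norm_comparable by metis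
  obtain \<delta> C where \<delta>: "\<delta> > 0" "C > 0" and near: "\<And>\<tau> x y. \<lbrakk>\<tau> \<in> T; x \<in> X; dist x y < \<delta>\<rbrakk>
      \<Longrightarrow> dist (\<Phi> \<tau> x) (\<Phi> \<tau> y) \<le> C * sup_deriv_norm \<tau> * dist x y"
    using \<Phi>_dist_le by metis
  obtain \<alpha> l where l: "0 < \<alpha>" "\<alpha> < pi" "0 < l"
    "\<And>x. x \<in> frontier X \<Longrightarrow> \<exists>v. norm v = 1 \<and> open_cone x \<alpha> l v \<subseteq> interior X"
    using cone_condition by blast
  obtain c where c: "c > 0" and inner: "\<And>x \<rho>. \<lbrakk>x \<in> X; 0 < \<rho>; \<rho> \<le> l\<rbrakk>
      \<Longrightarrow> \<exists>y. dist x y \<le> \<rho> \<and> ball y (c * \<rho>) \<subseteq> interior X"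
    using cone_condition_inner_balls[OF l] by blast
  define k where "k = min l (\<delta> / 2)"
  have k: "0 < k" "k \<le> l" "k < \<delta>"
    using l \<delta> by (auto simp: k_def)
  define M where "M = ((1 + C * k + c * k / K) / (c * k / K)) ^ DIM('a)"
  have "M \<ge> 0"
    using \<delta> c k K by (simp add: M_def)
  have "real (card {p\<in>T. height p = n \<and> r < sup_deriv_norm p \<and> \<Phi> p ` X \<inter> U \<noteq> {}}) \<le> M"
    (is "real (card ?P) \<le> M") if r: "0 < r" and U: "bounded U" "diameter U \<le> r" for n r U
  proof -
    define P where "P = ?P"
    have P: "p \<in> T" "height p = n" "r < sup_deriv_norm p" "\<Phi> p ` X \<inter> U \<noteq> {}" if "p \<in> P" for p
      using that by (auto simp: P_def)
    (* the scale in X that \<Phi> p maps to scale r *)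
    define \<rho> where "\<rho> p = k * r / sup_deriv_norm p" for p
    define Q where "Q p x y \<longleftrightarrow> x \<in> X \<and> \<Phi> p x \<in> U \<and> dist x y \<le> \<rho> p
      \<and> ball y (c * \<rho> p) \<subseteq> interior X" for p x y
    have \<rho>: "0 < \<rho> p" "\<rho> p \<le> k" "sup_deriv_norm p * \<rho> p = k * r" if "p \<in> P" for p
      using P(3)[OF that] r k by (auto simp: \<rho>_def field_simps)
    have "\<exists>x y. Q p x y"
      if p: "p \<in> P" for p
    proof -
      obtain x where "x \<in> X" "\<Phi> p x \<in> U"
        using P(4)[OF p] by blast
      moreover obtain y where "dist x y \<le> \<rho> p" "ball y (c * \<rho> p) \<subseteq> interior X"
        using inner[of x "\<rho> p"] \<open>x \<in> X\<close> \<rho>(1,2)[OF p] k by auto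
      ultimately show ?thesis
        unfolding Q_def by blast
    qed
    then obtain x y where "\<And>p. p \<in> P \<Longrightarrow> Q p (x p) (y p)"
      by metis
    then have xy: "x p \<in> X \<and> \<Phi> p (x p) \<in> U \<and>
        dist (x p) (y p) \<le> \<rho> p \<and> ball (y p) (c * \<rho> p) \<subseteq> interior X" if "p \<in> P" for p
      using that unfolding Q_def by blast
    define a where "a = c * k / K * r"
    have a: "a > 0"
      using c k K r by (simp add: a_def)
    have image: "ball (\<Phi> p (y p)) a \<subseteq> \<Phi> p ` interior X" if p: "p \<in> P" for p
    proof -
      note pT = P(1)[OF p]
      have sub: "ball (y p) (c * \<rho> p) \<subseteq> V"
        using xy[OF p] interior_subset X_subset_V by blast
      have "ball (\<Phi> p (y p)) (sup_deriv_norm p / K * (c * \<rho> p)) \<subseteq> \<Phi> p ` ball (y p) (c * \<rho> p)"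
      proof (rule ball_subset_image_if_expanding)
        show "0 < sup_deriv_norm p / K" "0 < c * \<rho> p"
          using sup_deriv_norm_pos[OF pT] K(1) c \<rho>(1)[OF p] by auto
        show "inj_on (\<Phi> p) (ball (y p) (c * \<rho> p))"
          using \<Phi>_inj_on[OF pT] sub inj_on_subset by blast
        fix z assume z: "z \<in> ball (y p) (c * \<rho> p)"
        then have sim: "similarity_at (\<Phi> p) z"
          using \<Phi>_similarity_at[OF pT] sub by blast
        then show "(\<Phi> p has_derivative frechet_derivative (\<Phi> p) (at z)) (at z)"
          by (rule similarity_atD(2))
        have "sup_deriv_norm p / K \<le> deriv_norm (\<Phi> p) z"
          using K(2)[OF pT subsetD[OF sub z]] K(1) by (simp add: field_simps)
        then show "sup_deriv_norm p / K * norm h \<le> norm (frechet_derivative (\<Phi> p) (at z) h)" for h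
          unfolding similarity_atD(3)[OF sim] by (rule mult_right_mono) simp
      qed
      moreover have "sup_deriv_norm p / K * (c * \<rho> p) = a"
        using \<rho>(3)[OF p] by (simp add: a_def mult.commute mult.left_commute)
      ultimately show ?thesis
        using xy[OF p] by (metis image_mono order_trans)
    qed
    show ?thesis
    proof (cases "P = {}")
      case True
      then show ?thesis
        using \<open>M \<ge> 0\<close> unfolding P_def by (metis card.empty of_nat_0)
    next
      case False
      then obtain p0 where p0: "p0 \<in> P"
        by blast
      define u where "u = \<Phi> p0 (x p0)"
      have "u \<in> U"
        using xy[OF p0] by (simp add: u_def)
      have "real (card P) \<le> ((r + C * (k * r) + a) / a) ^ DIM('a)"
      proof (rule disjoint_balls_card_bound)
        show "finite P"
          using finite_level[of n] by (rule rev_finite_subset) (use P in blast)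
        show "ball (\<Phi> p (y p)) a \<inter> ball (\<Phi> q (y q)) a = {}" if "p \<in> P" "q \<in> P" "p \<noteq> q" for p q
          using image[OF that(1)] image[OF that(2)] \<Phi>_interiors_disjoint[of p q] P that by fastforce
        show "ball (\<Phi> p (y p)) a \<subseteq> ball u (r + C * (k * r) + a)" if p: "p \<in> P" for p
        proof
          fix z assume z: "z \<in> ball (\<Phi> p (y p)) a"
          have "dist u (\<Phi> p (x p)) \<le> r"
            using diameter_bounded_bound[OF U(1) \<open>u \<in> U\<close>, of "\<Phi> p (x p)"] xy[OF p] U(2) by simp
          moreover have "dist (\<Phi> p (x p)) (\<Phi> p (y p)) \<le> C * (k * r)"
          proof -
            have "dist (\<Phi> p (x p)) (\<Phi> p (y p)) \<le> C * sup_deriv_norm p * dist (x p) (y p)"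
              using near[of p "x p" "y p"] xy[OF p] \<rho>[OF p] k P(1)[OF p] by auto
            also have "\<dots> \<le> C * sup_deriv_norm p * \<rho> p"
              using xy[OF p] \<delta>(2) sup_deriv_norm_pos[OF P(1)[OF p]] by (intro mult_left_mono) auto
            finally show ?thesis
              using \<rho>(3)[OF p] by (simp add: mult.assoc)
          qed
          ultimately show "z \<in> ball u (r + C * (k * r) + a)"
            using z dist_triangle[of u z "\<Phi> p (x p)"] dist_triangle[of "\<Phi> p (x p)" z "\<Phi> p (y p)"]
            by simp
        qed
      qed (use a r \<delta> k in auto)
      also have "(r + C * (k * r) + a) / a = (1 + C * k + c * k / K) / (c * k / K)"
      proof -
        have "r + C * (k * r) + a = (1 + C * k + c * k / K) * r"
          by (simp add: a_def algebra_simps)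
        then show ?thesis
          using r by (simp add: a_def)
      qed
      finally show ?thesis
        by (simp add: M_def P_def)
    qed
  qed
  then show ?thesis
    using that \<open>M \<ge> 0\<close> by blast
qed

text \<open>Beyond some height the hypothesis gives the bound with constant \<open>1\<close>; the constant absorbs the
  finitely many remaining nodes.\<close>

lemma successors_card_bound:
  assumes subexponential_splitting "q > 1"
  obtains D where "D > 0" "\<And>\<tau>. \<tau> \<in> T \<Longrightarrow> real (card (successors \<tau>)) \<le> D * q ^ height \<tau>"
proof -
  have "\<forall>\<^sub>F \<tau> in inf (filtercomap height at_top) (principal T).
      1 / real (height \<tau>) * ln (real (card (successors \<tau>))) < ln q"
    using assms unfolding subexponential_splitting_def by (intro order_tendstoD(2)) auto
  then obtain N where N: "\<And>\<tau>. \<lbrakk>\<tau> \<in> T; N \<le> height \<tau>\<rbrakk>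
      \<Longrightarrow> 1 / real (height \<tau>) * ln (real (card (successors \<tau>))) < ln q"
    unfolding eventually_inf_principal eventually_filtercomap_at_top_linorder by blast
  define D where "D = 1 + (\<Sum>\<tau>\<in>truncation N. real (card (successors \<tau>)))"
  have sum0: "0 \<le> (\<Sum>\<tau>\<in>truncation N. real (card (successors \<tau>)))"
    by (intro sum_nonneg) simp
  have "real (card (successors \<tau>)) \<le> D * q ^ height \<tau>" if \<tau>: "\<tau> \<in> T" for \<tau>
  proof (cases "height \<tau> \<le> N")
    case True
    then have "real (card (successors \<tau>)) \<le> (\<Sum>\<tau>\<in>truncation N. real (card (successors \<tau>)))"
      using \<tau> finite_truncation by (intro member_le_sum) (auto simp: truncation_def)
    also have "\<dots> \<le> D * 1"
      by (simp add: D_def)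
    also have "\<dots> \<le> D * q ^ height \<tau>"
      using sum0 assms(2) by (intro mult_left_mono one_le_power) (auto simp: D_def)
    finally show ?thesis .
  next
    case False
    have card: "real (card (successors \<tau>)) > 0"
      using pruned[OF \<tau>] finitely_splitting[OF \<tau>] by (simp add: card_gt_0_iff)
    have "ln (real (card (successors \<tau>))) < real (height \<tau>) * ln q"
      using N[OF \<tau>] False by (simp add: field_simps)
    also have "\<dots> = ln (q ^ height \<tau>)"
      using assms(2) by (simp add: ln_realpow)
    finally have "real (card (successors \<tau>)) \<le> q ^ height \<tau>"
      using card assms(2) by simp
    also have "\<dots> \<le> D * q ^ height \<tau>"
      using sum0 assms(2) mult_right_mono[of 1 D "q ^ height \<tau>"] by (simp add: D_def)
    finally show ?thesis .
  qed
  then show ?thesis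
    using that[of D] sum0 by (auto simp: D_def)
qed

text \<open>Along a path the derivative norms fall from \<open>1\<close> towards \<open>0\<close>, so a path whose limit point lies in
  \<open>U\<close> passes the scale \<open>r < 1\<close> at a node of this set. The norm of such a node may be far below \<open>r\<close>;
  only that of its parent is bounded below.\<close>

definition crossing :: "real \<Rightarrow> 'a set \<Rightarrow> 't set" where
  "crossing r U = {\<omega>\<in>T. \<omega> \<noteq> root \<and> sup_deriv_norm \<omega> \<le> r \<and> r < sup_deriv_norm (parent \<omega>)
     \<and> \<Phi> \<omega> ` X \<inter> U \<noteq> {}}"

lemma infinite_path_crosses:
  assumes \<omega>: "\<omega> \<in> infinite_paths" and "0 < r" "r < 1" "coding \<omega> \<in> U"
  shows "\<exists>n. \<omega> n \<in> crossing r U"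
proof -
  obtain s where s: "0 < s" "s < 1" "\<And>\<tau>. \<tau> \<in> T \<Longrightarrow> sup_deriv_norm \<tau> \<le> s ^ height \<tau>"
    using sup_deriv_norm_contracts by metis
  define n where "n = (LEAST n. sup_deriv_norm (\<omega> n) \<le> r)"
  obtain m where "s ^ m < r"
    using real_arch_pow_inv[OF \<open>0 < r\<close> s(2)] by blast
  then have "sup_deriv_norm (\<omega> m) \<le> r"
    using s(3)[of "\<omega> m"] infinite_pathD(1,2)[OF \<omega>, of m] by simp
  then have n: "sup_deriv_norm (\<omega> n) \<le> r"
    unfolding n_def by (rule LeastI)
  have "n \<noteq> 0"
    using n \<open>r < 1\<close> \<omega> by (intro notI) (simp add: infinite_paths_def)
  then obtain k where k: "n = Suc k"
    using not0_implies_Suc by blast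
  then have "r < sup_deriv_norm (\<omega> k)"
    using not_less_Least[of k "\<lambda>n. sup_deriv_norm (\<omega> n) \<le> r"] n_def by simp
  then have "\<omega> n \<in> crossing r U"
    using n k infinite_pathD[OF \<omega>] coding_in_image[OF \<omega>, of n] assms(4)
    by (auto simp: crossing_def)
  then show ?thesis
    by blast
qed

text \<open>The parents of crossing nodes on one level are boundedly many, but \<open>r\<close> admits about
  \<open>log (1 / r)\<close> levels, and each parent may have many children. Both losses are at most a small
  negative power of \<open>r\<close>, because a parent of height \<open>h\<close> forces \<open>r < s ^ h\<close>; splitting that power in
  two halves leaves a convergent geometric series over the levels.\<close>

lemma crossing_sum_bound:
  assumes subexponential_splitting "t' < t" "0 \<le> t"
  obtains C where "C \<ge> 0"
    "\<And>r U. \<lbrakk>0 < r; bounded U; diameter U \<le> r\<rbrakk> \<Longrightarrow> finite (crossing r U)"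
    "\<And>r U. \<lbrakk>0 < r; bounded U; diameter U \<le> r\<rbrakk> \<Longrightarrow>
      (\<Sum>\<omega>\<in>crossing r U. sup_deriv_norm \<omega> powr t) \<le> C * r powr t'"
proof -
  obtain M where M: "M \<ge> 0" "\<And>n r U. \<lbrakk>0 < r; bounded U; diameter U \<le> r\<rbrakk> \<Longrightarrow>
      real (card {p\<in>T. height p = n \<and> r < sup_deriv_norm p \<and> \<Phi> p ` X \<inter> U \<noteq> {}}) \<le> M"
    using large_images_card_bound by blast
  obtain s where s: "0 < s" "s < 1" "\<And>\<tau>. \<tau> \<in> T \<Longrightarrow> sup_deriv_norm \<tau> \<le> s ^ height \<tau>"
    using sup_deriv_norm_contracts by metis
  (* one \<eta> bounds the branching, the other makes the series over the levels converge *)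
  define \<eta> where "\<eta> = (t - t') / 2"
  have \<eta>: "\<eta> > 0" "t = t' + 2 * \<eta>"
    using assms by (auto simp: \<eta>_def field_simps)
  define w where "w = s powr \<eta>"
  have w: "0 < w" "w < 1"
    using powr_less_mono2[of \<eta> s 1] s \<eta> by (auto simp: w_def)
  have "1 / w > 1"
    using w by simp
  then obtain D where D: "D > 0" "\<And>\<tau>. \<tau> \<in> T \<Longrightarrow> real (card (successors \<tau>)) \<le> D * (1 / w) ^ height \<tau>"
    using successors_card_bound[OF assms(1)] by blast
  define C where "C = D * M / (1 - w)"
  have "finite (crossing r U) \<and> (\<Sum>\<omega>\<in>crossing r U. sup_deriv_norm \<omega> powr t) \<le> C * r powr t'"
    if r: "0 < r" and U: "bounded U" "diameter U \<le> r" for r U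
  proof -
    define P where "P h = {p\<in>T. height p = h \<and> r < sup_deriv_norm p \<and> \<Phi> p ` X \<inter> U \<noteq> {}}" for h
    have finP: "finite (P h)" for h
      unfolding P_def using finite_level[of h] by (rule rev_finite_subset) blast
    have scale: "r < s ^ h" if "p \<in> P h" for p h
      using that s(3)[of p] by (auto simp: P_def)
    obtain H where H: "s ^ H < r"
      using real_arch_pow_inv[OF r s(2)] by blast
    have sub: "crossing r U \<subseteq> (\<Union>h<H. \<Union>p\<in>P h. successors p)"
    proof
      fix \<omega> assume \<omega>: "\<omega> \<in> crossing r U"
      then have \<omega>T: "\<omega> \<in> T" "\<omega> \<noteq> root"
        by (auto simp: crossing_def)
      have p: "parent \<omega> \<in> P (height (parent \<omega>))"
        using \<omega> parent_in[OF \<omega>T] \<Phi>_parent_image[OF \<omega>T] by (auto simp: P_def crossing_def)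
      have "height (parent \<omega>) < H"
      proof (rule ccontr)
        assume "\<not> height (parent \<omega>) < H"
        then have "s ^ height (parent \<omega>) \<le> s ^ H"
          using s by (intro power_decreasing) auto
        then show False
          using scale[OF p] H by linarith
      qed
      then show "\<omega> \<in> (\<Union>h<H. \<Union>p\<in>P h. successors p)"
        using p in_successors_parent[OF \<omega>T] by blast
    qed
    have fin_succ: "finite (\<Union>p\<in>P h. successors p)" for h
      using finP finitely_splitting by (auto simp: P_def)
    then have fin: "finite (crossing r U)"
      using finite_subset[OF sub] by blast
    have card_level: "real (card (\<Union>p\<in>P h. successors p)) \<le> D * M * r powr (- 2 * \<eta>) * w ^ h" for h
    proof -
      have each: "real (card (successors p)) \<le> D * (r powr (- 2 * \<eta>) * w ^ h)" if p: "p \<in> P h" for p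
      proof -
        have "(s ^ h) powr (- 2 * \<eta>) \<le> r powr (- 2 * \<eta>)"
          using scale[OF p] r \<eta> by (intro powr_mono2') auto
        moreover have "(1 / w) ^ h = (s ^ h) powr (- 2 * \<eta>) * w ^ h"
        proof -
          have "(s ^ h) powr (- 2 * \<eta>) = 1 / (w ^ h * w ^ h)"
            using s unfolding w_def
            by (simp add: powr_minus powr_realpow[symmetric] powr_powr field_simps flip: powr_add)
          then show ?thesis
            using w by (simp add: power_divide)
        qed
        ultimately have "(1 / w) ^ h \<le> r powr (- 2 * \<eta>) * w ^ h"
          using w by (simp add: mult_right_mono)
        then have "D * (1 / w) ^ h \<le> D * (r powr (- 2 * \<eta>) * w ^ h)"
          using D(1) by (intro mult_left_mono) auto
        then show ?thesis
          using D(2)[of p] p by (auto simp: P_def)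
      qed
      have "real (card (\<Union>p\<in>P h. successors p)) \<le> (\<Sum>p\<in>P h. real (card (successors p)))"
        using card_UN_le[OF finP, of successors h] by (simp flip: of_nat_sum)
      also have "\<dots> \<le> real (card (P h)) * (D * (r powr (- 2 * \<eta>) * w ^ h))"
        using each by (intro sum_bounded_above)
      also have "\<dots> \<le> M * (D * (r powr (- 2 * \<eta>) * w ^ h))"
        using M(2)[OF r U, of h] D w by (intro mult_right_mono) (auto simp: P_def)
      finally show ?thesis
        by (simp add: mult_ac)
    qed
    have "real (card (crossing r U)) \<le> real (card (\<Union>h<H. \<Union>p\<in>P h. successors p))"
      using card_mono[OF _ sub] fin_succ by simp
    also have "\<dots> \<le> (\<Sum>h<H. real (card (\<Union>p\<in>P h. successors p)))"
      using card_UN_le[of "{..<H}" "\<lambda>h. \<Union>p\<in>P h. successors p"] by (simp flip: of_nat_sum)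
    also have "\<dots> \<le> (\<Sum>h<H. D * M * r powr (- 2 * \<eta>) * w ^ h)"
      by (intro sum_mono card_level)
    also have "\<dots> = D * M * r powr (- 2 * \<eta>) * (\<Sum>h<H. w ^ h)"
      by (simp add: sum_distrib_left)
    also have "\<dots> \<le> D * M * r powr (- 2 * \<eta>) * (1 / (1 - w))"
      using w D(1) M(1) sum_gp_strict[of w H] by (intro mult_left_mono) (auto simp: divide_right_mono)
    finally have card: "real (card (crossing r U)) \<le> C * r powr (- 2 * \<eta>)"
      by (simp add: C_def)
    have "(\<Sum>\<omega>\<in>crossing r U. sup_deriv_norm \<omega> powr t) \<le> real (card (crossing r U)) * r powr t"
      using sup_deriv_norm_pos \<open>0 \<le> t\<close>
      by (intro sum_bounded_above powr_mono2) (auto simp: crossing_def less_imp_le)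
    also have "\<dots> \<le> C * r powr (- 2 * \<eta>) * r powr t"
      using card by (intro mult_right_mono) auto
    also have "\<dots> = C * r powr t'"
      using \<eta> by (simp add: mult.assoc flip: powr_add)
    finally show ?thesis
      using fin by blast
  qed
  moreover have "C \<ge> 0"
    using w D M by (simp add: C_def)
  ultimately show ?thesis
    using that by blast
qed

text \<open>Every infinite path crosses the scale of a member of the cover, so the crossing nodes contain a
  maximal antichain. This is how a cover of the limit set by arbitrary sets, which has nothing to do
  with the tree, is turned into a competitor in the definition of \<open>Z_star\<close>.\<close>

lemma Z_star_inf_le_cover_sum:
  assumes subexponential_splitting "t' < t" "0 \<le> t"
  obtains C where "C \<ge> 0"
    "\<And>U r. \<lbrakk>limit_set \<subseteq> (\<Union>i. U i); \<And>i. bounded (U i); \<And>i. diameter (U i) \<le> r i;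
      \<And>i. 0 < r i; \<And>i. r i < 1; summable (\<lambda>i. r i powr t')\<rbrakk>
      \<Longrightarrow> Z_star_inf t \<le> C * (\<Sum>i. r i powr t')"
proof -
  obtain C where C: "C \<ge> 0"
    "\<And>r U. \<lbrakk>0 < r; bounded U; diameter U \<le> r\<rbrakk> \<Longrightarrow> finite (crossing r U)"
    "\<And>r U. \<lbrakk>0 < r; bounded U; diameter U \<le> r\<rbrakk> \<Longrightarrow>
      (\<Sum>\<omega>\<in>crossing r U. sup_deriv_norm \<omega> powr t) \<le> C * r powr t'"
    using crossing_sum_bound[OF assms] by blast
  have "Z_star_inf t \<le> C * (\<Sum>i. r i powr t')"
    if cover: "limit_set \<subseteq> (\<Union>i. U i)" and U: "\<And>i. bounded (U i)" "\<And>i. diameter (U i) \<le> r i"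
      and r: "\<And>i. 0 < r i" "\<And>i. r i < 1" and summ: "summable (\<lambda>i. r i powr t')"
    for U :: "nat \<Rightarrow> 'a set" and r
  proof -
    define B where "B = (\<Union>i. crossing (r i) (U i))"
    have "\<exists>n. \<omega> n \<in> B" if \<omega>: "\<omega> \<in> infinite_paths" for \<omega>
    proof -
      obtain i where "coding \<omega> \<in> U i"
        using cover \<omega> by (auto simp: limit_set_def)
      then show ?thesis
        using infinite_path_crosses[OF \<omega> r(1,2), of "U i" i] by (auto simp: B_def)
    qed
    moreover have "root \<notin> B"
      by (simp add: B_def crossing_def)
    ultimately obtain n A where A: "n \<ge> 1" "A \<subseteq> B"
      "maximal_antichain_in (truncation n - {root}) (\<preceq>) A"
      using cut_contains_maximal_antichain by blast
    have "A \<subseteq> truncation n"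
      using maximal_antichainD[OF A(3)] by (auto simp: antichain_in_def)
    then have finA: "finite A"
      using finite_truncation finite_subset by blast
    have "\<forall>\<omega>\<in>A. \<exists>j. \<omega> \<in> crossing (r j) (U j)"
      using A(2) by (auto simp: B_def)
    from bchoice[OF this] obtain i where i: "\<And>\<omega>. \<omega> \<in> A \<Longrightarrow> \<omega> \<in> crossing (r (i \<omega>)) (U (i \<omega>))"
      by blast
    have fin: "finite (crossing (r j) (U j))" for j
      using C(2) r U by blast
    have "Z_star_inf t \<le> (\<Sum>\<omega>\<in>A. sup_deriv_norm \<omega> powr t)"
      using Z_star_inf_le_sum A by blast
    also have "\<dots> = (\<Sum>j\<in>i ` A. \<Sum>\<omega>\<in>{\<omega>\<in>A. i \<omega> = j}. sup_deriv_norm \<omega> powr t)"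
      by (rule sum.image_gen[OF finA])
    also have "\<dots> \<le> (\<Sum>j\<in>i ` A. \<Sum>\<omega>\<in>crossing (r j) (U j). sup_deriv_norm \<omega> powr t)"
      using fin by (intro sum_mono sum_mono2) (auto dest: i)
    also have "\<dots> \<le> (\<Sum>j\<in>i ` A. C * r j powr t')"
      using C(3) r U by (intro sum_mono) auto
    also have "\<dots> = C * (\<Sum>j\<in>i ` A. r j powr t')"
      by (simp add: sum_distrib_left)
    also have "\<dots> \<le> C * (\<Sum>i. r i powr t')"
      using C(1) summ finA by (intro mult_left_mono sum_le_suminf) auto
    finally show ?thesis .
  qed
  then show ?thesis
    using that C(1) by blast
qed

end

section \<open>Covers and Hausdorff null sets\<close>

text \<open>The radii \<open>r i\<close> are positive although a diameter may be \<open>0\<close>, since a scale \<open>0\<close> is crossed by no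
  path; the excess is summable. Raising the exponent from \<open>s\<close> to \<open>t\<close> costs nothing, as all diameters
  are at most \<open>1\<close>, and avoids the special role of the exponent \<open>0\<close>.\<close>

lemma hausdorff_null_cover:
  fixes E :: "'a::metric_space set"
  assumes null: "hausdorff_measure s E = 0" and "0 \<le> s" "s < t" "0 < e"
  obtains U r where "E \<subseteq> (\<Union>i. U i)" "\<And>i::nat. bounded (U i)" "\<And>i. diameter (U i) \<le> r i"
    "\<And>i. 0 < r i" "\<And>i. r i < 1" "summable (\<lambda>i. r i powr t)" "(\<Sum>i. r i powr t) \<le> e"
proof -
  define e' where "e' = min e 1 / 2"
  have e': "0 < e'" "2 * e' \<le> e" "2 * e' \<le> 1"
    using \<open>0 < e\<close> by (auto simp: e'_def)
  have "(INF U\<in>delta_covers (1 / 2) E. \<Sum>i. diam_power s (U i)) \<le> hausdorff_measure s E"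
    unfolding hausdorff_measure_def by (rule SUP_upper) simp
  then have "(INF U\<in>delta_covers (1 / 2) E. \<Sum>i. diam_power s (U i)) < ennreal e'"
    using null e' by simp
  then obtain U where U: "U \<in> delta_covers (1 / 2) E" "(\<Sum>i. diam_power s (U i)) < ennreal e'"
    by (auto simp: INF_less_iff)
  have bdd: "bounded (U i)" "diameter (U i) \<le> 1 / 2" "0 \<le> diameter (U i)" for i
    using U(1) diameter_ge_0 by (auto simp: delta_covers_def)
  define a where "a i = diameter (U i) powr t" for i
  have "ennreal (a i) \<le> diam_power s (U i)" for i
  proof -
    have "a i \<le> diameter (U i) powr s"
      unfolding a_def using bdd[of i] assms by (intro powr_mono') auto
    moreover have "a i \<le> 1"
      unfolding a_def using bdd[of i] assms by (intro powr_le1) auto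
    ultimately show ?thesis
      using assms by (auto simp: diam_power_def a_def intro!: ennreal_leI)
  qed
  then have "(\<Sum>i. ennreal (a i)) \<le> (\<Sum>i. diam_power s (U i))"
    by (intro suminf_le) auto
  then have lt: "(\<Sum>i. ennreal (a i)) < ennreal e'"
    using U(2) by simp
  have a0: "0 \<le> a i" for i
    by (simp add: a_def)
  have summ: "summable a"
    using lt by (intro summable_suminf_not_top[OF a0]) (auto simp: less_top[symmetric] dest: less_trans)
  then have sum_a: "suminf a < e'"
    using lt suminf_ennreal2[OF a0 summ] e'(1) suminf_nonneg[OF summ a0] by (simp add: ennreal_less_iff)
  define b where "b i = a i + e' * (1 / 2) ^ Suc i" for i
  have b: "0 < b i" "a i \<le> b i" for i
    using e'(1) a0[of i] by (auto simp: b_def intro: add_nonneg_pos)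
  have "(\<lambda>i. a i + e' * (1 / 2) ^ Suc i) sums (suminf a + e' * 1)"
    by (intro sums_add sums_mult power_half_series summable_sums summ)
  then have b_sums: "b sums (suminf a + e')"
    by (simp add: b_def[abs_def])
  have b_lt: "b i < 1" for i
  proof -
    have "b i \<le> suminf b"
      using sum_le_suminf[of b "{i}"] b b_sums by (auto simp: sums_iff less_imp_le)
    then show ?thesis
      using b_sums sum_a e' by (simp add: sums_iff)
  qed
  have "t > 0"
    using assms by simp
  have r_powr: "(b i powr (1 / t)) powr t = b i" for i
    using b(1)[of i] \<open>t > 0\<close> by (simp add: powr_powr)
  show ?thesis
  proof (rule that[of U "\<lambda>i. b i powr (1 / t)"])
    show "E \<subseteq> (\<Union>i. U i)"
      using U(1) by (simp add: delta_covers_def)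
    show "diameter (U i) \<le> b i powr (1 / t)" for i
    proof -
      have "diameter (U i) = a i powr (1 / t)"
        using bdd(3)[of i] \<open>t > 0\<close> by (simp add: a_def powr_powr)
      also have "\<dots> \<le> b i powr (1 / t)"
        using a0 b \<open>t > 0\<close> by (intro powr_mono2) auto
      finally show ?thesis .
    qed
    show "b i powr (1 / t) < 1" for i
      using powr_less_mono2[of "1 / t" "b i" 1] b[of i] b_lt[of i] \<open>t > 0\<close> by simp
    show "0 < b i powr (1 / t)" for i
      using b(1)[of i] by simp
    show "summable (\<lambda>i. (b i powr (1 / t)) powr t)" "(\<Sum>i. (b i powr (1 / t)) powr t) \<le> e"
      using b_sums sum_a e' by (auto simp: r_powr sums_iff)
  qed (rule bdd)
qed

lemma hausdorff_null_if_finite_covers: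
  fixes E :: "'a::metric_space set" and F :: "'i \<Rightarrow> 'a set"
  assumes "0 < t"
    and covers: "\<And>\<delta> e. \<lbrakk>0 < \<delta>; 0 < e\<rbrakk> \<Longrightarrow> \<exists>A. finite A \<and> E \<subseteq> (\<Union>a\<in>A. F a)
      \<and> (\<forall>a\<in>A. bounded (F a) \<and> diameter (F a) \<le> \<delta>) \<and> (\<Sum>a\<in>A. diameter (F a) powr t) \<le> e"
  shows "hausdorff_measure t E = 0"
proof -
  have "(INF U\<in>delta_covers \<delta> E. \<Sum>i. diam_power t (U i)) \<le> 0" if "0 < \<delta>" for \<delta>
  proof (rule ennreal_le_epsilon)
    fix e :: real assume "0 < e"
    obtain A where A: "finite A" "E \<subseteq> (\<Union>a\<in>A. F a)"
      "\<And>a. a \<in> A \<Longrightarrow> bounded (F a) \<and> diameter (F a) \<le> \<delta>" "(\<Sum>a\<in>A. diameter (F a) powr t) \<le> e"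
      using covers[OF \<open>0 < \<delta>\<close> \<open>0 < e\<close>] by blast
    obtain f where f: "bij_betw f {..<card A} A"
      using ex_bij_betw_nat_finite[OF A(1)] by (auto simp: atLeast0LessThan)
    define U where "U i = (if i < card A then F (f i) else {})" for i
    have fA: "f i \<in> A" if "i < card A" for i
      using f that by (auto simp: bij_betw_def)
    have "E \<subseteq> (\<Union>i. U i)"
    proof
      fix x assume "x \<in> E"
      then obtain a where "a \<in> A" "x \<in> F a"
        using A(2) by blast
      then obtain i where "i < card A" "f i = a"
        using bij_betw_imp_surj_on[OF f] by (metis imageE lessThan_iff)
      then have "x \<in> U i"
        using \<open>x \<in> F a\<close> by (simp add: U_def)
      then show "x \<in> (\<Union>i. U i)"
        by blast
    qed
    then have "U \<in> delta_covers \<delta> E"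
      using A(3) fA \<open>0 < \<delta>\<close> by (auto simp: delta_covers_def U_def)
    then have "(INF U\<in>delta_covers \<delta> E. \<Sum>i. diam_power t (U i)) \<le> (\<Sum>i. diam_power t (U i))"
      by (rule INF_lower)
    also have "\<dots> = (\<Sum>i<card A. diam_power t (U i))"
      by (intro suminf_finite) (auto simp: U_def diam_power_def)
    also have "\<dots> \<le> (\<Sum>i<card A. ennreal (diameter (F (f i)) powr t))"
      using \<open>0 < t\<close> by (intro sum_mono) (auto simp: U_def diam_power_def)
    also have "\<dots> = ennreal (\<Sum>i<card A. diameter (F (f i)) powr t)"
      by (intro sum_ennreal) simp
    also have "(\<Sum>i<card A. diameter (F (f i)) powr t) = (\<Sum>a\<in>A. diameter (F a) powr t)"
      by (rule sum.reindex_bij_betw[OF f])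
    finally show "(INF U\<in>delta_covers \<delta> E. \<Sum>i. diam_power t (U i)) \<le> 0 + ennreal e"
      using A(4) ennreal_leI order_trans by fastforce
  qed
  then have "hausdorff_measure t E \<le> 0"
    unfolding hausdorff_measure_def by (intro SUP_least) auto
  then show ?thesis
    by simp
qed

section \<open>The dimension of the limit set\<close>

context conformal_TIFS
begin

text \<open>For exponent \<open>0\<close> the sum counts the nodes of a nonempty antichain.\<close>

lemma Z_star_inf_0_ge_1: "1 \<le> Z_star_inf 0"
proof (rule ccontr)
  assume "\<not> 1 \<le> Z_star_inf 0"
  then obtain n A where A: "n \<ge> 1" "maximal_antichain_in (truncation n - {root}) (\<preceq>) A"
    "(\<Sum>\<omega>\<in>A. sup_deriv_norm \<omega> powr 0) < 1"
    using Z_star_inf_approximated[of 0 1] by auto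
  have sub: "A \<subseteq> truncation n"
    using maximal_antichainD[OF A(2)] by (auto simp: antichain_in_def)
  obtain \<sigma> where "\<sigma> \<in> T" "height \<sigma> = n"
    using extends_to_height[OF root_in, of n] by auto
  then have "\<sigma> \<in> truncation n - {root}"
    using A(1) by (auto simp: truncation_def)
  then have "A \<noteq> {}"
    using maximal_antichain_comparable[OF A(2)] by blast
  moreover have "finite A"
    using sub finite_truncation finite_subset by blast
  ultimately have "1 \<le> real (card A)"
    by (simp add: Suc_leI card_gt_0_iff)
  moreover have "(\<Sum>\<omega>\<in>A. sup_deriv_norm \<omega> powr 0) = real (card A)"
  proof -
    have "sup_deriv_norm \<omega> powr 0 = 1" if "\<omega> \<in> A" for \<omega>
      using sup_deriv_norm_pos[of \<omega>] sub that by (auto simp: truncation_def)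
    then show ?thesis by simp
  qed
  ultimately show False
    using A(3) by linarith
qed

text \<open>A maximal antichain meets every infinite path, so its cylinders cover the limit set. For \<open>t > 0\<close>
  a small sum forces each cylinder to be small, so that these covers are fine enough.\<close>

lemma hausdorff_dim_limit_set_le:
  assumes "0 \<le> t" "Z_star_inf t = 0"
  shows "hausdorff_dim limit_set \<le> ereal t"
proof -
  have "t \<noteq> 0"
    using assms(2) Z_star_inf_0_ge_1 by auto
  then have "0 < t"
    using assms(1) by simp
  obtain C where C: "C > 0" "\<And>\<tau>. \<tau> \<in> T \<Longrightarrow> diameter (\<Phi> \<tau> ` X) \<le> C * sup_deriv_norm \<tau>"
    using \<Phi>_diameter_le by blast
  have bdd: "bounded (\<Phi> \<tau> ` X)" if "\<tau> \<in> T" for \<tau>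
    using \<Phi>_maps_X[OF that] compact_imp_bounded[OF X_compact] bounded_subset by blast
  have "hausdorff_measure t limit_set = 0"
    using \<open>0 < t\<close>
  proof (rule hausdorff_null_if_finite_covers[where F = "\<lambda>\<tau>. \<Phi> \<tau> ` X"])
    fix \<delta> e :: real assume "0 < \<delta>" "0 < e"
    then have "0 < min ((\<delta> / C) powr t) (e / C powr t)"
      using C(1) by simp
    then obtain n A where A: "n \<ge> 1" "maximal_antichain_in (truncation n - {root}) (\<preceq>) A"
      and small: "(\<Sum>\<omega>\<in>A. sup_deriv_norm \<omega> powr t) < min ((\<delta> / C) powr t) (e / C powr t)"
      using Z_star_inf_approximated[of t] assms(2) by metis
    have sub: "A \<subseteq> truncation n"
      using maximal_antichainD[OF A(2)] by (auto simp: antichain_in_def)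
    then have fin: "finite A" and AT: "A \<subseteq> T"
      using finite_truncation finite_subset by (auto simp: truncation_def)
    have "limit_set \<subseteq> (\<Union>\<tau>\<in>A. \<Phi> \<tau> ` X)"
    proof
      fix x assume "x \<in> limit_set"
      then obtain \<omega> where \<omega>: "\<omega> \<in> infinite_paths" "x = coding \<omega>"
        by (auto simp: limit_set_def)
      then show "x \<in> (\<Union>\<tau>\<in>A. \<Phi> \<tau> ` X)"
        using maximal_antichain_meets_path[OF A(2,1)] coding_in_image by blast
    qed
    moreover have "diameter (\<Phi> \<tau> ` X) \<le> \<delta>" if \<tau>: "\<tau> \<in> A" for \<tau>
    proof -
      have "sup_deriv_norm \<tau> powr t \<le> (\<Sum>\<omega>\<in>A. sup_deriv_norm \<omega> powr t)"
        using fin \<tau> by (intro member_le_sum) auto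
      then have "sup_deriv_norm \<tau> powr t < (\<delta> / C) powr t"
        using small by simp
      then have "sup_deriv_norm \<tau> < \<delta> / C"
        using powr_mono2[of t "\<delta> / C" "sup_deriv_norm \<tau>"] \<open>0 < t\<close> \<open>0 < \<delta>\<close> C(1) by fastforce
      then show ?thesis
        using C(2)[of \<tau>] C(1) AT \<tau> by (force simp: field_simps)
    qed
    moreover have "(\<Sum>\<tau>\<in>A. diameter (\<Phi> \<tau> ` X) powr t) \<le> e"
    proof -
      have "(\<Sum>\<tau>\<in>A. diameter (\<Phi> \<tau> ` X) powr t) \<le> (\<Sum>\<tau>\<in>A. C powr t * sup_deriv_norm \<tau> powr t)"
      proof (rule sum_mono)
        fix \<tau> assume "\<tau> \<in> A"
        then have "\<tau> \<in> T"
          using AT by blast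
        then have "diameter (\<Phi> \<tau> ` X) powr t \<le> (C * sup_deriv_norm \<tau>) powr t"
          using C(2) \<open>0 < t\<close> diameter_ge_0[OF bdd] by (intro powr_mono2) auto
        then show "diameter (\<Phi> \<tau> ` X) powr t \<le> C powr t * sup_deriv_norm \<tau> powr t"
          using C(1) sup_deriv_norm_pos[OF \<open>\<tau> \<in> T\<close>] by (simp add: powr_mult)
      qed
      also have "\<dots> = C powr t * (\<Sum>\<tau>\<in>A. sup_deriv_norm \<tau> powr t)"
        by (simp add: sum_distrib_left)
      also have "\<dots> \<le> C powr t * (e / C powr t)"
        using small by (intro mult_left_mono) auto
      finally show ?thesis
        using C(1) by simp
    qed
    ultimately show "\<exists>A. finite A \<and> limit_set \<subseteq> (\<Union>\<tau>\<in>A. \<Phi> \<tau> ` X)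
      \<and> (\<forall>\<tau>\<in>A. bounded (\<Phi> \<tau> ` X) \<and> diameter (\<Phi> \<tau> ` X) \<le> \<delta>)
      \<and> (\<Sum>\<tau>\<in>A. diameter (\<Phi> \<tau> ` X) powr t) \<le> e"
      using fin AT bdd by blast
  qed
  then show ?thesis
    unfolding hausdorff_dim_def using assms(1) by (intro INF_lower) simp
qed

text \<open>If the measure vanished for some \<open>s < t\<close>, covers with arbitrarily small sums of exponent
  strictly between \<open>s\<close> and \<open>t\<close> would make \<open>Z_star_inf t\<close> arbitrarily small; the gap between the
  exponents pays for the number of children.\<close>

lemma hausdorff_dim_limit_set_ge:
  assumes subexponential_splitting "0 \<le> t" "0 < Z_star_inf t"
  shows "ereal t \<le> hausdorff_dim limit_set"
  unfolding hausdorff_dim_def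
proof (rule INF_greatest)
  fix s assume "s \<in> {s. 0 \<le> s \<and> hausdorff_measure s limit_set = 0}"
  then have s: "0 \<le> s" "hausdorff_measure s limit_set = 0"
    by auto
  show "ereal t \<le> ereal s"
  proof (rule ccontr)
    assume "\<not> ereal t \<le> ereal s"
    then have "s < t"
      by simp
    (* also positive when s = 0, where the Hausdorff sums would merely count the sets *)
    define t' where "t' = (s + t) / 2"
    have t': "s < t'" "t' < t"
      using \<open>s < t\<close> by (auto simp: t'_def)
    obtain C where C: "C \<ge> 0"
      "\<And>U r. \<lbrakk>limit_set \<subseteq> (\<Union>i. U i); \<And>i. bounded (U i); \<And>i. diameter (U i) \<le> r i;
        \<And>i. 0 < r i; \<And>i. r i < 1; summable (\<lambda>i. r i powr t')\<rbrakk>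
        \<Longrightarrow> Z_star_inf t \<le> C * (\<Sum>i. r i powr t')"
      using Z_star_inf_le_cover_sum[OF assms(1) t'(2) assms(2)] by blast
    define e where "e = Z_star_inf t / (C + 1) / 2"
    have "e > 0"
      using assms(3) C(1) by (simp add: e_def)
    obtain U r where "limit_set \<subseteq> (\<Union>i. U i)" "\<And>i::nat. bounded (U i)" "\<And>i. diameter (U i) \<le> r i"
      "\<And>i. 0 < r i" "\<And>i. r i < 1" "summable (\<lambda>i. r i powr t')"
      and sum: "(\<Sum>i. r i powr t') \<le> e"
      using hausdorff_null_cover[OF s(2,1) t'(1) \<open>e > 0\<close>] by metis
    then have "Z_star_inf t \<le> C * (\<Sum>i. r i powr t')"
      by (intro C(2))
    also have "\<dots> \<le> C * e"
      using sum C(1) by (intro mult_left_mono)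
    also have "\<dots> \<le> (C + 1) * e"
      using \<open>e > 0\<close> by (simp add: algebra_simps)
    also have "\<dots> < Z_star_inf t"
      using assms(3) C(1) by (simp add: e_def field_simps add_pos_nonneg)
    finally show False
      by simp
  qed
qed

lemma hausdorff_dim_limit_set_eq:
  assumes subexponential_splitting
  shows "hausdorff_dim limit_set = beta_star"
proof (rule antisym)
  show "hausdorff_dim limit_set \<le> beta_star"
    unfolding beta_star_def using hausdorff_dim_limit_set_le by (intro INF_greatest) auto
  show "beta_star \<le> hausdorff_dim limit_set"
  proof (rule ccontr)
    assume "\<not> beta_star \<le> hausdorff_dim limit_set"
    then obtain t where t: "hausdorff_dim limit_set < ereal t" "ereal t < beta_star"
      using ereal_dense2[of "hausdorff_dim limit_set" beta_star] by (auto simp: not_le)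
    have "0 \<le> hausdorff_dim limit_set"
      unfolding hausdorff_dim_def by (intro INF_greatest) auto
    then have "0 \<le> t"
      using t(1) by (metis ereal_less_eq(5) less_imp_le order_trans)
    then have "Z_star_inf t \<noteq> 0"
      using t(2) INF_lower[of t "{t. 0 \<le> t \<and> Z_star_inf t = 0}" ereal]
      unfolding beta_star_def by auto
    then have "ereal t \<le> hausdorff_dim limit_set"
      using hausdorff_dim_limit_set_ge[OF assms \<open>0 \<le> t\<close>] Z_star_inf_nonneg[of t] by simp
    then show False
      using t(1) by simp
  qed
qed

end

theorem theorem1p1:
  fixes T :: "'t set" and le :: "'t \<Rightarrow> 't \<Rightarrow> bool" and root :: 't
    and X V :: "'a::euclidean_space set" and \<phi> :: "'t \<Rightarrow> 'a \<Rightarrow> 'a" and t :: real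
  assumes "conformal_TIFS T le root X \<phi> V" and "t \<ge> 0"
  shows "(conformal_TIFS.Z_star_inf T le root X \<phi> t = 0 \<longrightarrow>
            hausdorff_dim (TIFS.limit_set T le root X \<phi>) \<le> ereal t) \<and>
         (rooted_tree.subexponential_splitting T le \<longrightarrow>
            (conformal_TIFS.Z_star_inf T le root X \<phi> t > 0 \<longrightarrow>
               ereal t \<le> hausdorff_dim (TIFS.limit_set T le root X \<phi>)) \<and>
            hausdorff_dim (TIFS.limit_set T le root X \<phi>) = conformal_TIFS.beta_star T le root X \<phi>)"
proof -
  interpret conformal_TIFS T le root X \<phi> V
    by fact
  show ?thesis
    using hausdorff_dim_limit_set_le[OF assms(2)] hausdorff_dim_limit_set_ge[OF _ assms(2)]
      hausdorff_dim_limit_set_eq by blast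
qed

end
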